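(* Let $n\in\mathbb{N}_{\ge 1}$ and $\beta\in(0,1]$. Then $\mathcal{D}^{n,\beta}(\mathbb{R}^d)$ is a group (with respect to composition). In general, left translations in $\mathcal{D}^{n,\beta}(\mathbb{R}^d)$ are discontinuous.
   Context: $C^{n,\beta}_0(\mathbb{R}^d,\mathbb{R}^d)$ is the Banach space of $C^n$-maps $f:\mathbb{R}^d\to\mathbb{R}^d$ with $f^{(l)}(x)\to0$ as $\|x\|\to\infty$ for all $0\le l\le n$ and $\|f\|_{n,\beta}:=\max\{\|f\|_n,[f]_{n,\beta}\}<\infty$, where $\|f\|_n:=\sup\{\|f^{(l)}(x)\|: x\in\mathbb{R}^d,\,0\le l\le n\}$ and $[f]_{n,\beta}:=\sup_{x\ne y}\|f^{(n)}(x)-f^{(n)}(y)\|/\|x-y\|^\beta$ (operator norms of multilinear maps). $\mathcal{D}^{n,\beta}(\mathbb{R}^d):=\{\Phi\in \mathrm{Id}+C^{n,\beta}_0(\mathbb{R}^d,\mathbb{R}^d): \det d\Phi(x)>0\ \forall x\in\mathbb{R}^d\}$, with the topology given by the metric $d(\Phi_1,\Phi_2):=\|\Phi_1-\Phi_2\|_{n,\beta}$. The left translation by $\Psi\in\mathcal{D}^{n,\beta}(\mathbb{R}^d)$ is the map $\mathcal{D}^{n,\beta}(\mathbb{R}^d)\to\mathcal{D}^{n,\beta}(\mathbb{R}^d)$, $\Phi\mapsto\Psi\circ\Phi$. *)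

theory Defs
  imports "HOL-Analysis.Analysis" "HOL-Algebra.Group"
begin

text \<open>
  An \<open>l\<close>-linear map is represented by a function on lists, of which only the values on lists of
  length \<open>l\<close> matter. The derivative \<open>f\<^sup>(\<^sup>l\<^sup>)(x)\<close> is the \<open>l\<close>-fold iterated Frechet derivative, with
  the outermost differentiation in the direction of the head of the list.
\<close>

primrec nth_deriv ::
  "nat \<Rightarrow> ('a::real_normed_vector \<Rightarrow> 'b::real_normed_vector) \<Rightarrow> 'a \<Rightarrow> 'a list \<Rightarrow> 'b" where
  "nth_deriv 0 f x vs = f x"
| "nth_deriv (Suc l) f x vs = frechet_derivative (\<lambda>y. nth_deriv l f y (tl vs)) (at x) (hd vs)"

definition opnorm :: "nat \<Rightarrow> ('a::real_normed_vector list \<Rightarrow> 'b::real_normed_vector) \<Rightarrow> ennreal" where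
  "opnorm l T = (SUP vs\<in>{vs. length vs = l \<and> (\<forall>v\<in>set vs. norm v \<le> 1)}. ennreal (norm (T vs)))"

text \<open>
  The spaces being finite-dimensional, differentiability and continuity of the maps \<open>f\<^sup>(\<^sup>l\<^sup>)\<close> into
  the multilinear maps may be tested on each tuple of arguments.
\<close>

definition Cn_map :: "nat \<Rightarrow> ('a::euclidean_space \<Rightarrow> 'b::euclidean_space) \<Rightarrow> bool" where
  "Cn_map n f \<longleftrightarrow>
     (\<forall>l<n. \<forall>vs. length vs = l \<longrightarrow> (\<forall>x. (\<lambda>y. nth_deriv l f y vs) differentiable (at x))) \<and>
     (\<forall>l\<le>n. \<forall>vs. length vs = l \<longrightarrow> continuous_on UNIV (\<lambda>y. nth_deriv l f y vs))"

definition Cn_norm :: "nat \<Rightarrow> ('a::euclidean_space \<Rightarrow> 'b::euclidean_space) \<Rightarrow> ennreal" where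
  "Cn_norm n f = (SUP (l, x)\<in>{..n} \<times> UNIV. opnorm l (nth_deriv l f x))"

definition holder_seminorm ::
  "nat \<Rightarrow> real \<Rightarrow> ('a::euclidean_space \<Rightarrow> 'b::euclidean_space) \<Rightarrow> ennreal" where
  "holder_seminorm n \<beta> f =
     (SUP (x, y)\<in>{(x, y). x \<noteq> y}.
        opnorm n (\<lambda>vs. nth_deriv n f x vs - nth_deriv n f y vs) / ennreal (norm (x - y) powr \<beta>))"

definition holder_norm ::
  "nat \<Rightarrow> real \<Rightarrow> ('a::euclidean_space \<Rightarrow> 'b::euclidean_space) \<Rightarrow> ennreal" where
  "holder_norm n \<beta> f = max (Cn_norm n f) (holder_seminorm n \<beta> f)"

definition C0_holder :: "nat \<Rightarrow> real \<Rightarrow> ('a::euclidean_space \<Rightarrow> 'b::euclidean_space) set" where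
  "C0_holder n \<beta> =
     {f. Cn_map n f \<and>
         (\<forall>l\<le>n. ((\<lambda>x. opnorm l (nth_deriv l f x)) \<longlongrightarrow> 0) at_infinity) \<and>
         holder_norm n \<beta> f < \<infinity>}"

definition holder_diffeos :: "nat \<Rightarrow> real \<Rightarrow> (real ^ 'd \<Rightarrow> real ^ 'd) set" where
  "holder_diffeos n \<beta> =
     {\<Phi>. (\<exists>f\<in>C0_holder n \<beta>. \<Phi> = (\<lambda>x. x + f x)) \<and>
         (\<forall>x. det (matrix (frechet_derivative \<Phi> (at x))) > 0)}"

text \<open>
  The value \<open>0\<close> off \<open>holder_diffeos n \<beta>\<close> is a dummy: the locale \<open>Metric_space\<close> wants its metric to
  be symmetric on the whole type.
\<close>

definition holder_dist ::
  "nat \<Rightarrow> real \<Rightarrow> (real ^ 'd \<Rightarrow> real ^ 'd) \<Rightarrow> (real ^ 'd \<Rightarrow> real ^ 'd) \<Rightarrow> real" where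
  "holder_dist n \<beta> \<Phi>\<^sub>1 \<Phi>\<^sub>2 =
     (if \<Phi>\<^sub>1 \<in> holder_diffeos n \<beta> \<and> \<Phi>\<^sub>2 \<in> holder_diffeos n \<beta>
      then enn2real (holder_norm n \<beta> (\<lambda>x. \<Phi>\<^sub>1 x - \<Phi>\<^sub>2 x)) else 0)"

definition holder_diffeo_topology :: "nat \<Rightarrow> real \<Rightarrow> (real ^ 'd \<Rightarrow> real ^ 'd) topology" where
  "holder_diffeo_topology n \<beta> = Metric_space.mtopology (holder_diffeos n \<beta>) (holder_dist n \<beta>)"

definition holder_diffeo_group :: "nat \<Rightarrow> real \<Rightarrow> (real ^ 'd \<Rightarrow> real ^ 'd) monoid" where
  "holder_diffeo_group n \<beta> = \<lparr>carrier = holder_diffeos n \<beta>, monoid.mult = (\<circ>), one = id\<rparr>"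

lemma nth_deriv_diff:
  assumes "Cn_map n f" "Cn_map n g" "l \<le> n" "length vs = l"
  shows "nth_deriv l (\<lambda>x. f x - g x) x vs = nth_deriv l f x vs - nth_deriv l g x vs"
  using assms(3,4)
proof (induction l arbitrary: x vs)
  case (Suc l)
  have len: "length (tl vs) = l" using Suc.prems by simp
  have "(\<lambda>y. nth_deriv l (\<lambda>x. f x - g x) y (tl vs)) =
        (\<lambda>y. nth_deriv l f y (tl vs) - nth_deriv l g y (tl vs))"
    using Suc.IH Suc.prems len by auto
  moreover have "(\<lambda>y. nth_deriv l f y (tl vs)) differentiable (at x)"
    "(\<lambda>y. nth_deriv l g y (tl vs)) differentiable (at x)"
    using assms(1,2) Suc.prems len by (auto simp: Cn_map_def)
  then have "((\<lambda>y. nth_deriv l f y (tl vs) - nth_deriv l g y (tl vs)) has_derivative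
     (\<lambda>h. frechet_derivative (\<lambda>y. nth_deriv l f y (tl vs)) (at x) h -
          frechet_derivative (\<lambda>y. nth_deriv l g y (tl vs)) (at x) h)) (at x)"
    by (intro has_derivative_diff) (auto simp: frechet_derivative_works)
  ultimately show ?case
    by (simp add: frechet_derivative_at[symmetric])
qed simp

lemma opnorm_triangle:
  assumes "\<And>vs. length vs = l \<Longrightarrow> norm (T vs) \<le> norm (S vs) + norm (R vs)"
  shows "opnorm l T \<le> opnorm l S + opnorm l R"
  unfolding opnorm_def
proof (rule SUP_least)
  fix vs :: "'a list" assume vs: "vs \<in> {vs. length vs = l \<and> (\<forall>v\<in>set vs. norm v \<le> 1)}"
  then have "ennreal (norm (T vs)) \<le> ennreal (norm (S vs)) + ennreal (norm (R vs))"
    using assms[of vs] by (simp flip: ennreal_plus)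
  also have "\<dots> \<le> (SUP vs\<in>{vs. length vs = l \<and> (\<forall>v\<in>set vs. norm v \<le> 1)}. ennreal (norm (S vs)))
     + (SUP vs\<in>{vs. length vs = l \<and> (\<forall>v\<in>set vs. norm v \<le> 1)}. ennreal (norm (R vs)))"
    using vs by (intro add_mono SUP_upper) auto
  finally show "ennreal (norm (T vs)) \<le> \<dots>" .
qed

lemma holder_norm_triangle:
  assumes fgh: "\<And>l x vs. l \<le> n \<Longrightarrow> length vs = l \<Longrightarrow>
      nth_deriv l f x vs = nth_deriv l g x vs + nth_deriv l h x vs"
  shows "holder_norm n \<beta> f \<le> holder_norm n \<beta> g + holder_norm n \<beta> h"
proof -
  have 1: "Cn_norm n f \<le> Cn_norm n g + Cn_norm n h"
    unfolding Cn_norm_def[of n f]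
  proof (rule SUP_least)
    fix p :: "nat \<times> 'a" assume "p \<in> {..n} \<times> UNIV"
    then obtain l x where p: "p = (l, x)" and l: "l \<le> n" by auto
    have "opnorm l (nth_deriv l f x) \<le> opnorm l (nth_deriv l g x) + opnorm l (nth_deriv l h x)"
      using l by (intro opnorm_triangle) (simp add: fgh norm_triangle_ineq)
    also have "\<dots> \<le> Cn_norm n g + Cn_norm n h"
      unfolding Cn_norm_def using l by (intro add_mono SUP_upper2[of "(l, x)"]) auto
    finally show "(case p of (l, x) \<Rightarrow> opnorm l (nth_deriv l f x)) \<le> Cn_norm n g + Cn_norm n h"
      by (simp add: p)
  qed
  have 2: "holder_seminorm n \<beta> f \<le> holder_seminorm n \<beta> g + holder_seminorm n \<beta> h"
    unfolding holder_seminorm_def[of n \<beta> f]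
  proof (rule SUP_least)
    fix p :: "'a \<times> 'a" assume "p \<in> {(x, y). x \<noteq> y}"
    then obtain x y where p: "p = (x, y)" and xy: "x \<noteq> y" by auto
    let ?q = "\<lambda>f::'a \<Rightarrow> 'b. opnorm n (\<lambda>vs. nth_deriv n f x vs - nth_deriv n f y vs)"
    let ?c = "ennreal (norm (x - y) powr \<beta>)"
    have "?q f \<le> ?q g + ?q h"
      by (intro opnorm_triangle) (simp add: fgh add_diff_add norm_triangle_ineq)
    then have "?q f / ?c \<le> ?q g / ?c + ?q h / ?c"
      by (metis add_divide_distrib_ennreal divide_right_mono_ennreal)
    also have "\<dots> \<le> holder_seminorm n \<beta> g + holder_seminorm n \<beta> h"
      unfolding holder_seminorm_def using xy by (intro add_mono SUP_upper2[of "(x, y)"]) auto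
    finally show "(case p of (x, y) \<Rightarrow> opnorm n (\<lambda>vs. nth_deriv n f x vs - nth_deriv n f y vs) /
        ennreal (norm (x - y) powr \<beta>)) \<le> holder_seminorm n \<beta> g + holder_seminorm n \<beta> h"
      by (simp add: p)
  qed
  show ?thesis
    unfolding holder_norm_def
    by (intro max.boundedI order_trans[OF 1] order_trans[OF 2] add_mono) auto
qed

lemma holder_norm_minus:
  assumes "\<And>l x vs. l \<le> n \<Longrightarrow> length vs = l \<Longrightarrow> nth_deriv l f x vs = - nth_deriv l g x vs"
  shows "holder_norm n \<beta> f = holder_norm n \<beta> g"
proof -
  have "opnorm l (nth_deriv l f x) = opnorm l (nth_deriv l g x)" if "l \<le> n" for l x
    unfolding opnorm_def using assms that by (intro SUP_cong) auto
  moreover have "opnorm n (\<lambda>vs. nth_deriv n f x vs - nth_deriv n f y vs) =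
      opnorm n (\<lambda>vs. nth_deriv n g x vs - nth_deriv n g y vs)" for x y
    unfolding opnorm_def using assms by (intro SUP_cong) (auto simp: norm_minus_commute)
  ultimately show ?thesis
    unfolding holder_norm_def Cn_norm_def holder_seminorm_def
    by (intro arg_cong2[of _ _ _ _ max] SUP_cong) auto
qed

lemma holder_norm_eq_0D:
  assumes "holder_norm n \<beta> f = 0"
  shows "f x = 0"
proof -
  have "ennreal (norm (f x)) \<le> opnorm 0 (nth_deriv 0 f x)"
    unfolding opnorm_def by (rule SUP_upper2[of "[]"]) auto
  also have "\<dots> \<le> Cn_norm n f"
    unfolding Cn_norm_def by (rule SUP_upper2[of "(0, x)"]) auto
  also have "\<dots> \<le> holder_norm n \<beta> f"
    by (simp add: holder_norm_def)
  finally show ?thesis using assms by simp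
qed

lemma Metric_space_holder_diffeos:
  "Metric_space (holder_diffeos n \<beta> :: (real ^ 'd \<Rightarrow> real ^ 'd) set) (holder_dist n \<beta>)"
proof -
  have D: "\<exists>f\<in>C0_holder n \<beta>. \<Phi> = (\<lambda>x. x + f x)" if "\<Phi> \<in> holder_diffeos n \<beta>"
    for \<Phi> :: "real ^ 'd \<Rightarrow> real ^ 'd"
    using that by (auto simp: holder_diffeos_def)
  have fin: "holder_norm n \<beta> (\<lambda>x. f x - g x) < \<infinity>"
    if "f \<in> C0_holder n \<beta>" "g \<in> C0_holder n \<beta>" for f g :: "real ^ 'd \<Rightarrow> real ^ 'd"
  proof -
    have C: "Cn_map n f" "Cn_map n g" using that by (auto simp: C0_holder_def)
    have z: "Cn_map n (\<lambda>x::real^'d. 0::real^'d)"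
    proof -
      have "nth_deriv l (\<lambda>x::real^'d. 0::real^'d) = (\<lambda>x vs. 0)" for l
        by (induction l) (auto simp: fun_eq_iff)
      then show ?thesis by (simp add: Cn_map_def)
    qed
    have nz: "nth_deriv l (\<lambda>x::real^'d. 0::real^'d) x vs = 0" for l x vs
      by (induction l arbitrary: x vs) auto
    have ng: "nth_deriv l (\<lambda>x. 0 - g x) x vs = - nth_deriv l g x vs" if "l \<le> n" "length vs = l" for l x vs
      using nth_deriv_diff[OF z C(2) that, of x] by (simp add: nz)
    have "holder_norm n \<beta> (\<lambda>x. f x - g x) \<le> holder_norm n \<beta> f + holder_norm n \<beta> (\<lambda>x. 0 - g x)"
      by (rule holder_norm_triangle) (simp add: nth_deriv_diff[OF C] ng del: diff_0)
    also have "holder_norm n \<beta> (\<lambda>x. 0 - g x) = holder_norm n \<beta> g"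
      by (rule holder_norm_minus) (rule ng)
    also have "holder_norm n \<beta> f + holder_norm n \<beta> g < \<infinity>"
      using that by (simp add: C0_holder_def)
    finally show ?thesis .
  qed
  have diff: "\<exists>f\<in>C0_holder n \<beta>. \<exists>g\<in>C0_holder n \<beta>. (\<lambda>x. \<Phi> x - \<Psi> x) = (\<lambda>x. f x - g x) \<and>
      (\<lambda>x. \<Psi> x - \<Phi> x) = (\<lambda>x. g x - f x)"
    if "\<Phi> \<in> holder_diffeos n \<beta>" "\<Psi> \<in> holder_diffeos n \<beta>" for \<Phi> \<Psi> :: "real ^ 'd \<Rightarrow> real ^ 'd"
    using D[OF that(1)] D[OF that(2)] by fastforce
  have fin': "holder_norm n \<beta> (\<lambda>x. \<Phi> x - \<Psi> x) < \<infinity>"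
    if "\<Phi> \<in> holder_diffeos n \<beta>" "\<Psi> \<in> holder_diffeos n \<beta>" for \<Phi> \<Psi> :: "real ^ 'd \<Rightarrow> real ^ 'd"
    using diff[OF that] fin by force
  have zero: "holder_norm n \<beta> (\<lambda>x::real^'d. 0::real^'d) = 0"
  proof -
    have nz: "nth_deriv l (\<lambda>x::real^'d. 0::real^'d) = (\<lambda>x vs. 0)" for l
      by (induction l) (auto simp: fun_eq_iff)
    have "opnorm l (\<lambda>vs::(real^'d) list. 0::real^'d) = 0" for l
      by (simp add: opnorm_def SUP_constant bot_ennreal)
    then show ?thesis
      by (simp add: holder_norm_def Cn_norm_def holder_seminorm_def nz case_prod_unfold SUP_constant
          bot_ennreal cong: SUP_cong)
  qed
  show ?thesis
  proof
    show "0 \<le> holder_dist n \<beta> \<Phi> \<Psi>" for \<Phi> \<Psi> :: "real ^ 'd \<Rightarrow> real ^ 'd"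
      by (simp add: holder_dist_def)
  next
    fix \<Phi> \<Psi> :: "real ^ 'd \<Rightarrow> real ^ 'd"
    have "holder_norm n \<beta> (\<lambda>x. \<Phi> x - \<Psi> x) = holder_norm n \<beta> (\<lambda>x. \<Psi> x - \<Phi> x)"
      if mem: "\<Phi> \<in> holder_diffeos n \<beta>" "\<Psi> \<in> holder_diffeos n \<beta>"
    proof -
      obtain f g where fg: "f \<in> C0_holder n \<beta>" "g \<in> C0_holder n \<beta>"
        "(\<lambda>x. \<Phi> x - \<Psi> x) = (\<lambda>x. f x - g x)" "(\<lambda>x. \<Psi> x - \<Phi> x) = (\<lambda>x. g x - f x)"
        using diff[OF mem] by blast
      then have C: "Cn_map n f" "Cn_map n g" by (auto simp: C0_holder_def)
      show ?thesis
        unfolding fg(3,4)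
        by (rule holder_norm_minus) (simp add: nth_deriv_diff[OF C] nth_deriv_diff[OF C(2,1)])
    qed
    then show "holder_dist n \<beta> \<Phi> \<Psi> = holder_dist n \<beta> \<Psi> \<Phi>"
      by (auto simp: holder_dist_def)
  next
    fix \<Phi> \<Psi> :: "real ^ 'd \<Rightarrow> real ^ 'd"
    assume mem: "\<Phi> \<in> holder_diffeos n \<beta>" "\<Psi> \<in> holder_diffeos n \<beta>"
    show "(holder_dist n \<beta> \<Phi> \<Psi> = 0) = (\<Phi> = \<Psi>)"
    proof
      assume "holder_dist n \<beta> \<Phi> \<Psi> = 0"
      then have "holder_norm n \<beta> (\<lambda>x. \<Phi> x - \<Psi> x) = 0"
        using fin'[OF mem] mem by (auto simp: holder_dist_def enn2real_eq_0_iff)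
      from holder_norm_eq_0D[OF this] show "\<Phi> = \<Psi>" by (simp add: fun_eq_iff)
    qed (simp add: holder_dist_def zero)
  next
    fix \<Phi> \<Psi> \<Xi> :: "real ^ 'd \<Rightarrow> real ^ 'd"
    assume mem: "\<Phi> \<in> holder_diffeos n \<beta>" "\<Psi> \<in> holder_diffeos n \<beta>" "\<Xi> \<in> holder_diffeos n \<beta>"
    obtain f g h where fgh: "f \<in> C0_holder n \<beta>" "g \<in> C0_holder n \<beta>" "h \<in> C0_holder n \<beta>"
      and eq: "\<Phi> = (\<lambda>x. x + f x)" "\<Psi> = (\<lambda>x. x + g x)" "\<Xi> = (\<lambda>x. x + h x)"
      using D mem by meson
    then have C: "Cn_map n f" "Cn_map n g" "Cn_map n h" by (auto simp: C0_holder_def)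
    have "holder_norm n \<beta> (\<lambda>x. f x - h x) \<le>
        holder_norm n \<beta> (\<lambda>x. f x - g x) + holder_norm n \<beta> (\<lambda>x. g x - h x)"
      by (rule holder_norm_triangle)
        (simp add: nth_deriv_diff[OF C(1,3)] nth_deriv_diff[OF C(1,2)] nth_deriv_diff[OF C(2,3)])
    then have "enn2real (holder_norm n \<beta> (\<lambda>x. f x - h x)) \<le>
        enn2real (holder_norm n \<beta> (\<lambda>x. f x - g x) + holder_norm n \<beta> (\<lambda>x. g x - h x))"
      using fin[OF fgh(1,2)] fin[OF fgh(2,3)] by (intro enn2real_mono) auto
    also have "\<dots> = enn2real (holder_norm n \<beta> (\<lambda>x. f x - g x)) + enn2real (holder_norm n \<beta> (\<lambda>x. g x - h x))"
      using fin[OF fgh(1,2)] fin[OF fgh(2,3)] by (intro enn2real_plus) auto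
    finally show "holder_dist n \<beta> \<Phi> \<Xi> \<le> holder_dist n \<beta> \<Phi> \<Psi> + holder_dist n \<beta> \<Psi> \<Xi>"
      using mem by (simp add: holder_dist_def eq)
  qed
qed

end

theory Submission
  imports Defs
begin

text \<open>
  Membership in \<open>C\<^sub>0\<^sup>n\<^sup>,\<^sup>\<beta>\<close> is equivalent to a condition defined by recursion on \<open>n\<close> through the
  partial derivatives, and the maps satisfying it form an algebra. For composition, the chain rule reads
  \<open>\<partial>\<^sub>i(f \<circ> (id + g)) = \<partial>\<^sub>if \<circ> (id + g) + \<Sum>\<^sub>j \<partial>\<^sub>ig\<^sub>j \<cdot> (\<partial>\<^sub>jf \<circ> (id + g))\<close>,
  which stays inside the algebra. A map \<open>id + f\<close> with invertible differential is onto by Brouwer's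
  theorem and one-to-one because the set of multiply covered points is open, closed and bounded. Its
  inverse \<open>id + k\<close> satisfies \<open>\<partial>\<^sub>ik + (f' \<circ> (id + k)) \<partial>\<^sub>ik = - \<partial>\<^sub>if \<circ> (id + k)\<close>, a
  linear system from which the regularity of \<open>k\<close> is bootstrapped.

  For the discontinuity take \<open>\<Psi> = id + \<delta> u e\<close> with \<open>u(x) = - max(0, - x \<bullet> e)\<^sup>n\<^sup>+\<^sup>\<beta>\<close> near the
  origin, and \<open>\<Phi>\<^sub>\<epsilon>\<close> close to the identity and equal to the translation by \<open>\<epsilon> e\<close> near the origin.
  The \<open>n\<close>-th derivative of \<open>\<Psi> - \<Psi> \<circ> \<Phi>\<^sub>\<epsilon>\<close> along \<open>e\<close> differs between \<open>0\<close> and \<open>- \<epsilon> e\<close> by a fixed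
  multiple of \<open>\<epsilon>\<^sup>\<beta>\<close>, so the Hoelder seminorm does not tend to \<open>0\<close>.
\<close>

section \<open>Vanishing Hoelder maps\<close>

lemma frechet_derivative_eqI:
  assumes "(f has_derivative f') (at x)"
  shows "frechet_derivative f (at x) = f'"
  using frechet_derivative_at[OF assms] by simp

lemma linear_expand_Basis:
  fixes f :: "'a::euclidean_space \<Rightarrow> 'b::real_normed_vector"
  assumes "linear f"
  shows "f v = (\<Sum>j\<in>Basis. (v \<bullet> j) *\<^sub>R f j)"
proof -
  have "f v = f (\<Sum>j\<in>Basis. (v \<bullet> j) *\<^sub>R j)"
    by (simp add: euclidean_representation)
  also have "\<dots> = (\<Sum>j\<in>Basis. (v \<bullet> j) *\<^sub>R f j)"
    using assms by (simp add: linear_sum linear_scale)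
  finally show ?thesis .
qed

text \<open>The limit bounds \<open>f\<close> by 1 outside a large ball; compactness bounds it
  inside.\<close>

lemma continuous_tendsto_0_at_infinity_bounded:
  fixes f :: "'a::euclidean_space \<Rightarrow> 'b::real_normed_vector"
  assumes "(f \<longlongrightarrow> 0) at_infinity" "continuous_on UNIV f"
  obtains B where "B > 0" "\<And>x. norm (f x) \<le> B"
proof -
  have "eventually (\<lambda>x. norm (f x) < 1) at_infinity"
    using tendstoD[OF assms(1), of 1] by simp
  then obtain R where R: "\<And>x. R \<le> norm x \<Longrightarrow> norm (f x) < 1"
    by (auto simp: eventually_at_infinity)
  have "compact (f ` cball 0 R)"
    using assms(2) by (intro compact_continuous_image) (auto intro: continuous_on_subset)
  then obtain B where B: "\<And>x. x \<in> cball 0 R \<Longrightarrow> norm (f x) \<le> B"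
    by (metis bounded_iff compact_imp_bounded imageI)
  have "norm (f x) \<le> max 1 B" for x
    using B[of x] R[of x] by (cases "norm x \<le> R") auto
  then show ?thesis using that[of "max 1 B"] by auto
qed

text \<open>
  The Hoelder condition is only imposed on the top derivatives: a vanishing map with vanishing
  continuous derivative is bounded and Lipschitz, hence Hoelder.
\<close>

primrec vanishing_holder ::
  "real \<Rightarrow> nat \<Rightarrow> ('a::euclidean_space \<Rightarrow> 'b::real_normed_vector) \<Rightarrow> bool" where
  "vanishing_holder \<beta> 0 f \<longleftrightarrow>
     (f \<longlongrightarrow> 0) at_infinity \<and> (\<exists>C. \<forall>x y. norm (f x - f y) \<le> C * norm (x - y) powr \<beta>)"
| "vanishing_holder \<beta> (Suc n) f \<longleftrightarrow>
     (f \<longlongrightarrow> 0) at_infinity \<and> (\<forall>x. f differentiable (at x)) \<and>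
     (\<forall>i\<in>Basis. vanishing_holder \<beta> n (\<lambda>x. frechet_derivative f (at x) i))"

text \<open>Working form of the recursion: inductions can supply an explicit derivative family
  \<open>f'\<close> instead of computing with \<open>frechet_derivative\<close>.\<close>

lemma vanishing_holder_SucI:
  assumes "(f \<longlongrightarrow> 0) at_infinity" "\<And>x. (f has_derivative f' x) (at x)"
    "\<And>i. i \<in> Basis \<Longrightarrow> vanishing_holder \<beta> n (\<lambda>x. f' x i)"
  shows "vanishing_holder \<beta> (Suc n) f"
proof -
  have "frechet_derivative f (at x) = f' x" for x
    using assms(2) by (rule frechet_derivative_eqI)
  then show ?thesis using assms by (auto simp: differentiable_def)
qed

lemma vanishing_holder_SucE:
  assumes "vanishing_holder \<beta> (Suc n) f"
  obtains f' where "(f \<longlongrightarrow> 0) at_infinity" "\<And>x. (f has_derivative f' x) (at x)"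
    "\<And>i. i \<in> Basis \<Longrightarrow> vanishing_holder \<beta> n (\<lambda>x. f' x i)"
  using assms that[of "\<lambda>x. frechet_derivative f (at x)"]
  by (auto simp: frechet_derivative_works[symmetric])

lemma vanishing_holder_tendsto:
  "vanishing_holder \<beta> n f \<Longrightarrow> (f \<longlongrightarrow> 0) at_infinity"
  by (cases n) auto

locale holder_exponent =
  fixes \<beta> :: real
  assumes beta_pos: "0 < \<beta>" and beta_le_1: "\<beta> \<le> 1"
begin

abbreviation vh :: "nat \<Rightarrow> ('a::euclidean_space \<Rightarrow> 'b::real_normed_vector) \<Rightarrow> bool" where
  "vh \<equiv> vanishing_holder \<beta>"

section \<open>Continuity, boundedness and Lipschitz bounds\<close>

lemma vanishing_holder_continuous:
  fixes f :: "'a::euclidean_space \<Rightarrow> 'b::real_normed_vector"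
  assumes "vh n f"
  shows "continuous_on UNIV f"
proof (cases n)
  case 0
  then obtain C where C: "\<And>x y. norm (f x - f y) \<le> C * norm (x - y) powr \<beta>"
    using assms by auto
  have "(f \<longlongrightarrow> f x) (at x)" for x
  proof (rule Lim_transform_bound[where g = "\<lambda>y. C * norm (y - x) powr \<beta>", THEN LIM_zero_cancel])
    show "\<forall>\<^sub>F y in at x. norm (f y - f x) \<le> norm (C * norm (y - x) powr \<beta>)"
    proof (intro always_eventually allI)
      fix y show "norm (f y - f x) \<le> norm (C * norm (y - x) powr \<beta>)"
        using C[of y x] by (simp add: abs_if split: if_splits)
    qed
    have "((\<lambda>y. C * norm (y - x) powr \<beta>) \<longlongrightarrow> C * norm (x - x) powr \<beta>) (at x)"
      using beta_pos by (intro tendsto_intros) auto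
    then show "((\<lambda>y. C * norm (y - x) powr \<beta>) \<longlongrightarrow> 0) (at x)" by simp
  qed
  then show ?thesis by (simp add: continuous_on_def)
next
  case (Suc m)
  then show ?thesis using assms
    by (auto intro!: differentiable_imp_continuous_on simp: differentiable_on_def)
qed

lemma vanishing_holder_bounded:
  fixes f :: "'a::euclidean_space \<Rightarrow> 'b::real_normed_vector"
  assumes "vh n f"
  obtains B where "B > 0" "\<And>x. norm (f x) \<le> B"
  using continuous_tendsto_0_at_infinity_bounded vanishing_holder_tendsto[OF assms]
    vanishing_holder_continuous[OF assms] by metis

text \<open>Each column of the derivative is a vanishing map, hence bounded, and the column bounds
  add up to a bound for the operator norm.\<close>

lemma vanishing_holder_derivative_bounded:
  fixes f :: "'a::euclidean_space \<Rightarrow> 'b::real_normed_vector"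
  assumes "vh (Suc n) f" and f': "\<And>x. (f has_derivative f' x) (at x)"
  obtains L where "L > 0" "\<And>x. onorm (f' x) \<le> L"
proof -
  have vh: "vh n (\<lambda>x. f' x i)" if "i \<in> Basis" for i
    using assms that frechet_derivative_eqI[OF f'] by simp
  have "\<forall>i\<in>Basis. \<exists>B. \<forall>x. norm (f' x i) \<le> B"
    using vanishing_holder_bounded[OF vh] by metis
  then obtain B where B: "\<And>i x. i \<in> Basis \<Longrightarrow> norm (f' x i) \<le> B i"
    by metis
  \<comment> \<open>The summand 1 makes \<open>L\<close> positive even when every \<open>B i\<close>
    is 0.\<close>
  define L where "L = 1 + (\<Sum>i\<in>Basis. B i)"
  have nn: "0 \<le> B i" if "i \<in> Basis" for i
    using B[OF that, of 0] norm_ge_zero order_trans by blast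
  then have L0: "L > 0" by (simp add: L_def add_pos_nonneg sum_nonneg)
  have "onorm (f' x) \<le> L" for x
  proof (rule onorm_le)
    fix v :: 'a
    have "linear (f' x)" using f' has_derivative_linear by blast
    then have "norm (f' x v) = norm (\<Sum>j\<in>Basis. (v \<bullet> j) *\<^sub>R f' x j)"
      by (simp flip: linear_expand_Basis)
    also have "\<dots> \<le> (\<Sum>j\<in>Basis. norm v * B j)"
      using B nn by (intro sum_norm_le) (auto intro!: mult_mono simp: Basis_le_norm)
    also have "\<dots> \<le> L * norm v"
      unfolding sum_distrib_left[symmetric] by (simp add: L_def algebra_simps)
    finally show "norm (f' x v) \<le> L * norm v" .
  qed
  with L0 show ?thesis using that by blast
qed

lemma vanishing_holder_Lipschitz:
  fixes f :: "'a::euclidean_space \<Rightarrow> 'b::real_normed_vector"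
  assumes "vh (Suc n) f"
  obtains L where "L > 0" "\<And>x y. norm (f x - f y) \<le> L * norm (x - y)"
proof -
  obtain f' where f': "\<And>x. (f has_derivative f' x) (at x)"
    using vanishing_holder_SucE[OF assms] by metis
  obtain L where L: "L > 0" "\<And>x. onorm (f' x) \<le> L"
    using vanishing_holder_derivative_bounded[OF assms f'] by metis
  have "norm (f x - f y) \<le> L * norm (x - y)" for x y
    using f' L(2) by (intro differentiable_bound[of UNIV]) auto
  with L(1) show ?thesis using that by blast
qed

text \<open>For distances \<open>d\<close> up to 1 the Lipschitz bound suffices, since
  \<open>d \<le> d powr \<beta>\<close> for \<open>\<beta> \<le> 1\<close>. Beyond 1 the oscillation
  is at most \<open>2 * B\<close> and \<open>d powr \<beta>\<close> is at least 1.\<close>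

lemma bounded_Lipschitz_imp_holder:
  fixes f :: "'a::real_normed_vector \<Rightarrow> 'b::real_normed_vector"
  assumes B: "\<And>x. norm (f x) \<le> B" and L: "\<And>x y. norm (f x - f y) \<le> L * norm (x - y)"
  shows "norm (f x - f y) \<le> (\<bar>L\<bar> + 2 * B) * norm (x - y) powr \<beta>"
proof -
  have B0: "0 \<le> B" using B norm_ge_zero order_trans by blast
  let ?d = "norm (x - y)"
  show ?thesis
  proof (cases "?d \<le> 1")
    case True
    have "?d \<le> ?d powr \<beta>"
      using powr_mono'[of \<beta> 1 "?d"] beta_le_1 True by auto
    then have "\<bar>L\<bar> * ?d \<le> (\<bar>L\<bar> + 2 * B) * ?d powr \<beta>"
      using B0 by (intro mult_mono) auto
    moreover have "L * ?d \<le> \<bar>L\<bar> * ?d" by (intro mult_right_mono) auto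
    ultimately show ?thesis using L[of x y] by linarith
  next
    case False
    have "norm (f x - f y) \<le> 2 * B"
      using norm_triangle_ineq4[of "f x" "f y"] B[of x] B[of y] by linarith
    moreover have "1 \<le> ?d powr \<beta>"
      using False beta_pos by (intro ge_one_powr_ge_zero) auto
    then have "2 * B * 1 \<le> (\<bar>L\<bar> + 2 * B) * ?d powr \<beta>"
      using B0 by (intro mult_mono) auto
    ultimately show ?thesis by simp
  qed
qed

lemma Lipschitz_imp_vanishing_holder_0:
  fixes f :: "'a::euclidean_space \<Rightarrow> 'b::real_normed_vector"
  assumes "(f \<longlongrightarrow> 0) at_infinity" and L: "\<And>x y. norm (f x - f y) \<le> L * norm (x - y)"
  shows "vh 0 f"
proof -
  have "continuous_on UNIV f"
  proof -
    have "(\<bar>L\<bar>)-lipschitz_on UNIV f"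
    proof (rule lipschitz_onI)
      fix x y :: 'a
      have "L * norm (x - y) \<le> \<bar>L\<bar> * norm (x - y)" by (intro mult_right_mono) auto
      then show "dist (f x) (f y) \<le> \<bar>L\<bar> * dist x y"
        using L[of x y] by (simp add: dist_norm)
    qed simp
    then show ?thesis by (rule lipschitz_on_continuous_on)
  qed
  then obtain B where "\<And>x. norm (f x) \<le> B"
    using continuous_tendsto_0_at_infinity_bounded[OF assms(1)] by metis
  from bounded_Lipschitz_imp_holder[OF this L] assms(1) show ?thesis
    by (auto simp del: powr_eq_0_iff)
qed

text \<open>Only the bottom of the recursion has content: a differentiable map at level 1 is bounded
  and Lipschitz, hence Hoelder. This lets products and compositions mix maps of different
  levels.\<close>

lemma vanishing_holder_SucD: "vh (Suc n) f \<Longrightarrow> vh n f"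
proof (induction n arbitrary: f)
  case 0
  then show ?case
    by (metis Lipschitz_imp_vanishing_holder_0 vanishing_holder_Lipschitz vanishing_holder_tendsto)
next
  case (Suc n)
  obtain f' where f': "(f \<longlongrightarrow> 0) at_infinity" "\<And>x. (f has_derivative f' x) (at x)"
    "\<And>i. i \<in> Basis \<Longrightarrow> vh (Suc n) (\<lambda>x. f' x i)"
    using vanishing_holder_SucE[OF Suc.prems] by metis
  show ?case
    by (rule vanishing_holder_SucI[OF f'(1,2) Suc.IH[OF f'(3)]])
qed

lemma vanishing_holder_mono: "vh n f \<Longrightarrow> m \<le> n \<Longrightarrow> vh m f"
  by (induction n) (auto simp: le_Suc_eq simp del: vanishing_holder.simps dest: vanishing_holder_SucD)

section \<open>Closure under linear maps, sums and products\<close>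

lemma vanishing_holder_bounded_linear:
  assumes "bounded_linear T"
  shows "vh n f \<Longrightarrow> vh n (\<lambda>x. T (f x))"
proof (induction n arbitrary: f)
  case 0
  obtain C where C: "\<And>x y. norm (f x - f y) \<le> C * norm (x - y) powr \<beta>" using 0 by auto
  obtain K where K: "0 \<le> K" "\<And>x. norm (T x) \<le> norm x * K"
    using bounded_linear.nonneg_bounded[OF assms] by blast
  have "norm (T (f x) - T (f y)) \<le> (C * K) * norm (x - y) powr \<beta>" for x y
  proof -
    have "norm (T (f x) - T (f y)) \<le> norm (f x - f y) * K"
      using K(2)[of "f x - f y"] assms by (simp add: linear_diff bounded_linear.linear)
    also have "\<dots> \<le> (C * norm (x - y) powr \<beta>) * K"
      using C K by (intro mult_right_mono) auto
    finally show ?thesis by (simp add: algebra_simps)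
  qed
  moreover have "((\<lambda>x. T (f x)) \<longlongrightarrow> 0) at_infinity"
    by (rule bounded_linear.tendsto_zero[OF assms]) (use 0 in simp)
  ultimately show ?case by auto
next
  case (Suc n)
  obtain f' where f': "(f \<longlongrightarrow> 0) at_infinity" "\<And>x. (f has_derivative f' x) (at x)"
    "\<And>i. i \<in> Basis \<Longrightarrow> vh n (\<lambda>x. f' x i)"
    using vanishing_holder_SucE[OF Suc.prems] by metis
  show ?case
  proof (rule vanishing_holder_SucI)
    show "((\<lambda>x. T (f x)) \<longlongrightarrow> 0) at_infinity"
      by (rule bounded_linear.tendsto_zero[OF assms f'(1)])
    show "((\<lambda>x. T (f x)) has_derivative (\<lambda>h. T (f' x h))) (at x)" for x
      by (rule bounded_linear.has_derivative[OF assms f'(2)])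
  qed (use Suc.IH f'(3) in auto)
qed

lemma vanishing_holder_zero: "vh n (\<lambda>x. 0)"
proof (induction n)
  case (Suc n)
  then show ?case by (auto intro!: vanishing_holder_SucI[where f' = "\<lambda>_ _. 0"])
qed (auto intro!: exI[of _ 0])

lemma vanishing_holder_add: "vh n f \<Longrightarrow> vh n g \<Longrightarrow> vh n (\<lambda>x. f x + g x)"
proof (induction n arbitrary: f g)
  case 0
  obtain C D where C: "\<And>x y. norm (f x - f y) \<le> C * norm (x - y) powr \<beta>"
    and D: "\<And>x y. norm (g x - g y) \<le> D * norm (x - y) powr \<beta>" using 0 by auto
  have "norm (f x + g x - (f y + g y)) \<le> (C + D) * norm (x - y) powr \<beta>" for x y
    using C[of x y] D[of x y] norm_triangle_ineq[of "f x - f y" "g x - g y"]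
    by (simp add: algebra_simps)
  then show ?case using 0 by (auto intro: tendsto_add_zero)
next
  case (Suc n)
  obtain f' where f': "(f \<longlongrightarrow> 0) at_infinity" "\<And>x. (f has_derivative f' x) (at x)"
    "\<And>i. i \<in> Basis \<Longrightarrow> vh n (\<lambda>x. f' x i)"
    using vanishing_holder_SucE[OF Suc.prems(1)] by metis
  obtain g' where g': "(g \<longlongrightarrow> 0) at_infinity" "\<And>x. (g has_derivative g' x) (at x)"
    "\<And>i. i \<in> Basis \<Longrightarrow> vh n (\<lambda>x. g' x i)"
    using vanishing_holder_SucE[OF Suc.prems(2)] by metis
  show ?case
  proof (rule vanishing_holder_SucI)
    show "((\<lambda>x. f x + g x) has_derivative (\<lambda>h. f' x h + g' x h)) (at x)" for x
      by (rule has_derivative_add[OF f'(2) g'(2)])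
  qed (use Suc.IH f' g' tendsto_add_zero in auto)
qed

lemma vanishing_holder_cmult: "vh n f \<Longrightarrow> vh n (\<lambda>x. c *\<^sub>R f x)"
  by (rule vanishing_holder_bounded_linear[OF bounded_linear_scaleR_right])

lemma vanishing_holder_minus: "vh n f \<Longrightarrow> vh n (\<lambda>x. - f x)"
  by (rule vanishing_holder_bounded_linear[OF bounded_linear_minus[OF bounded_linear_ident]])

lemma vanishing_holder_diff: "vh n f \<Longrightarrow> vh n g \<Longrightarrow> vh n (\<lambda>x. f x - g x)"
  using vanishing_holder_add[OF _ vanishing_holder_minus, of n f g] by simp

lemma vanishing_holder_inner: "vh n f \<Longrightarrow> vh n (\<lambda>x. f x \<bullet> c)"
  by (rule vanishing_holder_bounded_linear[OF bounded_linear_inner_left])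

lemma vanishing_holder_sum:
  assumes "finite A" "\<And>j. j \<in> A \<Longrightarrow> vh n (f j)"
  shows "vh n (\<lambda>x. \<Sum>j\<in>A. f j x)"
  using assms by (induction A) (auto intro: vanishing_holder_add vanishing_holder_zero simp del: vanishing_holder.simps)

text \<open>Leibniz rule. The undifferentiated factors drop one level by
  \<open>vanishing_holder_SucD\<close>, so the induction hypothesis applies to both terms; at level
  0 the boundedness of both factors yields the Hoelder estimate.\<close>

lemma vanishing_holder_scaleR: "vh n f \<Longrightarrow> vh n g \<Longrightarrow> vh n (\<lambda>x. f x *\<^sub>R g x)"
proof (induction n arbitrary: f g)
  case 0
  obtain C D where C: "\<And>x y. norm (f x - f y) \<le> C * norm (x - y) powr \<beta>"
    and D: "\<And>x y. norm (g x - g y) \<le> D * norm (x - y) powr \<beta>" using 0 by auto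
  obtain A B where A: "A > 0" "\<And>x. norm (f x) \<le> A" and B: "B > 0" "\<And>x. norm (g x) \<le> B"
    using vanishing_holder_bounded[OF 0(1)] vanishing_holder_bounded[OF 0(2)] by metis
  have "norm (f x *\<^sub>R g x - f y *\<^sub>R g y) \<le> (A * D + C * B) * norm (x - y) powr \<beta>" for x y
  proof -
    have "norm (f x *\<^sub>R g x - f y *\<^sub>R g y) = norm (f x *\<^sub>R (g x - g y) + (f x - f y) *\<^sub>R g y)"
      by (simp add: algebra_simps)
    also have "\<dots> \<le> norm (f x) * norm (g x - g y) + norm (f x - f y) * norm (g y)"
      by (rule norm_triangle_le) simp
    also have "\<dots> \<le> A * (D * norm (x - y) powr \<beta>) + (C * norm (x - y) powr \<beta>) * B"
      using A B C[of x y] D[of x y] order_trans[OF norm_ge_zero C[of x y]]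
      by (intro add_mono mult_mono) auto
    finally show ?thesis by (simp add: algebra_simps)
  qed
  moreover have "((\<lambda>x. f x *\<^sub>R g x) \<longlongrightarrow> 0) at_infinity"
    using tendsto_scaleR[of f 0 at_infinity g 0] 0 by simp
  ultimately show ?case by auto
next
  case (Suc n)
  obtain f' where f': "(f \<longlongrightarrow> 0) at_infinity" "\<And>x. (f has_derivative f' x) (at x)"
    "\<And>i. i \<in> Basis \<Longrightarrow> vh n (\<lambda>x. f' x i)"
    using vanishing_holder_SucE[OF Suc.prems(1)] by metis
  obtain g' where g': "(g \<longlongrightarrow> 0) at_infinity" "\<And>x. (g has_derivative g' x) (at x)"
    "\<And>i. i \<in> Basis \<Longrightarrow> vh n (\<lambda>x. g' x i)"
    using vanishing_holder_SucE[OF Suc.prems(2)] by metis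
  show ?case
  proof (rule vanishing_holder_SucI)
    show "((\<lambda>x. f x *\<^sub>R g x) \<longlongrightarrow> 0) at_infinity"
      using tendsto_scaleR[of f 0 at_infinity g 0] f' g' by simp
    show "((\<lambda>x. f x *\<^sub>R g x) has_derivative (\<lambda>h. f x *\<^sub>R g' x h + f' x h *\<^sub>R g x)) (at x)" for x
      by (rule has_derivative_scaleR[OF f'(2) g'(2)])
    show "vh n (\<lambda>x. f x *\<^sub>R g' x i + f' x i *\<^sub>R g x)" if "i \<in> Basis" for i
      using Suc.prems[THEN vanishing_holder_SucD] f'(3)[OF that] g'(3)[OF that]
      by (intro vanishing_holder_add Suc.IH)
  qed
qed

lemma vanishing_holder_mult:
  fixes f g :: "'a::euclidean_space \<Rightarrow> real"
  shows "vh n f \<Longrightarrow> vh n g \<Longrightarrow> vh n (\<lambda>x. f x * g x)"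
  using vanishing_holder_scaleR[of n f g] by simp


section \<open>Composition with near-identity maps and linear systems\<close>

text \<open>Since \<open>g\<close> vanishes at infinity, \<open>x + g x\<close> tends to infinity
  with \<open>x\<close>, which preserves decay. The Lipschitz bound on \<open>g\<close> is a
  separate hypothesis because level 0 of \<open>vh\<close> gives only a Hoelder bound, and composing
  two Hoelder maps would lower the exponent.\<close>

lemma vanishing_holder_compose:
  fixes f :: "'a::euclidean_space \<Rightarrow> 'b::real_normed_vector" and g :: "'a \<Rightarrow> 'a"
  assumes "vh n f" "vh n g" and L: "\<And>x y. norm (g x - g y) \<le> L * norm (x - y)"
  shows "vh n (\<lambda>x. f (x + g x))"
  using assms(1,2)
proof (induction n arbitrary: f)
  case 0
  have lim: "filterlim (\<lambda>x. x + g x) at_infinity at_infinity"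
    using vanishing_holder_tendsto[OF 0(2)] tendsto_add_filterlim_at_infinity' filterlim_ident by blast
  obtain C where C: "\<And>x y. norm (f x - f y) \<le> C * norm (x - y) powr \<beta>"
    using 0 by auto
  have "norm (f (x + g x) - f (y + g y)) \<le> (\<bar>C\<bar> * (1 + \<bar>L\<bar>) powr \<beta>) * norm (x - y) powr \<beta>" for x y
  proof -
    have "norm (x + g x - (y + g y)) \<le> norm (x - y) + norm (g x - g y)"
      using norm_triangle_ineq[of "x - y" "g x - g y"] by (simp add: algebra_simps)
    also have "\<dots> \<le> norm (x - y) + \<bar>L\<bar> * norm (x - y)"
      using L[of x y] mult_right_mono[OF abs_ge_self[of L] norm_ge_zero[of "x - y"]] by linarith
    finally have *: "norm (x + g x - (y + g y)) \<le> (1 + \<bar>L\<bar>) * norm (x - y)"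
      by (simp add: algebra_simps)
    have "norm (f (x + g x) - f (y + g y)) \<le> \<bar>C\<bar> * norm (x + g x - (y + g y)) powr \<beta>"
      using C[of "x + g x" "y + g y"]
        mult_right_mono[OF abs_ge_self[of C] powr_ge_zero[of "norm (x + g x - (y + g y))" \<beta>]] by linarith
    also have "\<dots> \<le> \<bar>C\<bar> * ((1 + \<bar>L\<bar>) * norm (x - y)) powr \<beta>"
      using * beta_pos by (intro mult_left_mono powr_mono2) auto
    finally show ?thesis by (simp add: powr_mult)
  qed
  moreover have "((\<lambda>x. f (x + g x)) \<longlongrightarrow> 0) at_infinity"
    using filterlim_compose[OF vanishing_holder_tendsto[OF 0(1)] lim] .
  ultimately show ?case by (auto simp del: powr_eq_0_iff)
next
  case (Suc n)
  have lim: "filterlim (\<lambda>x. x + g x) at_infinity at_infinity"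
    using vanishing_holder_tendsto[OF Suc.prems(2)] tendsto_add_filterlim_at_infinity' filterlim_ident
    by blast
  obtain f' where f': "(f \<longlongrightarrow> 0) at_infinity" "\<And>x. (f has_derivative f' x) (at x)"
    "\<And>i. i \<in> Basis \<Longrightarrow> vh n (\<lambda>x. f' x i)"
    using vanishing_holder_SucE[OF Suc.prems(1)] by metis
  obtain g' where g': "(g \<longlongrightarrow> 0) at_infinity" "\<And>x. (g has_derivative g' x) (at x)"
    "\<And>i. i \<in> Basis \<Longrightarrow> vh n (\<lambda>x. g' x i)"
    using vanishing_holder_SucE[OF Suc.prems(2)] by metis
  have IH: "vh n (\<lambda>x. f' (x + g x) j)" if "j \<in> Basis" for j
    by (rule Suc.IH[OF f'(3)[OF that] vanishing_holder_SucD[OF Suc.prems(2)]])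
  show ?case
  proof (rule vanishing_holder_SucI)
    show "((\<lambda>x. f (x + g x)) \<longlongrightarrow> 0) at_infinity"
      using filterlim_compose[OF f'(1) lim] .
    show "((\<lambda>x. f (x + g x)) has_derivative (\<lambda>h. f' (x + g x) (h + g' x h))) (at x)" for x
      by (rule has_derivative_compose[OF has_derivative_add[OF has_derivative_ident g'(2)] f'(2)])
    show "vh n (\<lambda>x. f' (x + g x) (i + g' x i))" if i: "i \<in> Basis" for i
    proof -
      \<comment> \<open>Expanding along the basis turns the chain rule into sums of products of maps
        already known to lie at level \<open>n\<close>.\<close>
      have "f' (x + g x) (i + g' x i) =
          f' (x + g x) i + (\<Sum>j\<in>Basis. (g' x i \<bullet> j) *\<^sub>R f' (x + g x) j)" for x
      proof -
        have lin: "linear (f' (x + g x))" using f'(2) has_derivative_linear by blast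
        show ?thesis
          unfolding linear_expand_Basis[OF lin, of "g' x i", symmetric] by (simp add: linear_add lin)
      qed
      then show ?thesis
        using IH g'(3)[OF i] i
        by (auto intro!: vanishing_holder_add vanishing_holder_sum vanishing_holder_scaleR
            vanishing_holder_inner)
    qed
  qed
qed

text \<open>
  Differentiating the equation for \<open>G\<close> gives an equation for the derivatives of \<open>G\<close> with the same
  \<open>F\<close> and a new right-hand side, so induction on \<open>n\<close> avoids any formula for the inverse matrix.
\<close>

lemma vanishing_holder_resolvent:
  fixes G H :: "'a::euclidean_space \<Rightarrow> 'b::euclidean_space" and F :: "'b \<Rightarrow> 'a \<Rightarrow> 'b"
  assumes c: "c > 0" and lower: "\<And>x v. c * norm v \<le> norm (v + (\<Sum>j\<in>Basis. (v \<bullet> j) *\<^sub>R F j x))"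
    and "\<And>j. j \<in> Basis \<Longrightarrow> vh n (F j)" "vh n H"
    and "\<And>x. G x + (\<Sum>j\<in>Basis. (G x \<bullet> j) *\<^sub>R F j x) = H x"
  shows "vh n G"
  using assms(3-5)
proof (induction n arbitrary: G H)
  case (0 G H)
  \<comment> \<open>The lower bound with \<open>v = G x\<close> passes decay and boundedness from
    \<open>H\<close> to \<open>G\<close>.\<close>
  have GH: "norm (G x) \<le> norm (H x) / c" for x
    using lower[of "G x" x] c 0(3)[of x] by (simp add: field_simps)
  have "((\<lambda>x. norm (H x) / c) \<longlongrightarrow> 0 / c) at_infinity"
    using vanishing_holder_tendsto[OF 0(2)] by (intro tendsto_intros tendsto_norm_zero) (use c in auto)
  then have "(G \<longlongrightarrow> 0) at_infinity"
    using GH by (intro Lim_null_comparison[of G]) auto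
  obtain B where B: "B > 0" "\<And>x. norm (H x) \<le> B" using vanishing_holder_bounded[OF 0(2)] by metis
  have GB: "norm (G x) \<le> B / c" for x
    using GH[of x] divide_right_mono[OF B(2)[of x], of c] c by linarith
  obtain CH where CH: "\<And>x y. norm (H x - H y) \<le> CH * norm (x - y) powr \<beta>" using 0(2) by auto
  have "\<forall>j\<in>Basis. \<exists>C. \<forall>x y. norm (F j x - F j y) \<le> C * norm (x - y) powr \<beta>"
    using 0(1) by auto
  then obtain C where C: "\<And>j x y. j \<in> Basis \<Longrightarrow> norm (F j x - F j y) \<le> C j * norm (x - y) powr \<beta>"
    by metis
  have "norm (G x - G y) \<le> ((CH + (\<Sum>j\<in>Basis. B / c * C j)) / c) * norm (x - y) powr \<beta>" for x y
  proof -
    let ?p = "norm (x - y) powr \<beta>"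
    have "c * norm (G x - G y) \<le> norm (G x - G y + (\<Sum>j\<in>Basis. ((G x - G y) \<bullet> j) *\<^sub>R F j x))"
      by (rule lower)
    \<comment> \<open>Subtract the equations at \<open>x\<close> and \<open>y\<close>, with the
      coefficients frozen at \<open>x\<close>. The error is the variation of \<open>F\<close>,
      weighted by the bounded coordinates of \<open>G y\<close>.\<close>
    also have "G x - G y + (\<Sum>j\<in>Basis. ((G x - G y) \<bullet> j) *\<^sub>R F j x) =
        H x - H y - (\<Sum>j\<in>Basis. (G y \<bullet> j) *\<^sub>R (F j x - F j y))"
      unfolding 0(3)[symmetric] by (simp add: algebra_simps sum_subtractf)
    also have "norm \<dots> \<le> norm (H x - H y) + norm (\<Sum>j\<in>Basis. (G y \<bullet> j) *\<^sub>R (F j x - F j y))"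
      by (rule norm_triangle_ineq4)
    also have "norm (\<Sum>j\<in>Basis. (G y \<bullet> j) *\<^sub>R (F j x - F j y)) \<le> (\<Sum>j\<in>Basis. B / c * (C j * ?p))"
    proof (rule sum_norm_le)
      fix j :: 'b assume j: "j \<in> Basis"
      have "\<bar>G y \<bullet> j\<bar> \<le> B / c" using Basis_le_norm[OF j, of "G y"] GB[of y] by linarith
      then show "norm ((G y \<bullet> j) *\<^sub>R (F j x - F j y)) \<le> B / c * (C j * ?p)"
        using C[OF j, of x y] B(1) c by (simp del: times_divide_eq_left add: mult_mono)
    qed
    also have "(\<Sum>j\<in>Basis. B / c * (C j * ?p)) = (\<Sum>j\<in>Basis. B / c * C j) * ?p"
      by (simp add: sum_distrib_right mult.assoc)
    also note CH[of x y]
    finally have "c * norm (G x - G y) \<le> (CH + (\<Sum>j\<in>Basis. B / c * C j)) * ?p"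
      by (simp add: distrib_right)
    then show ?thesis using c by (simp add: field_simps)
  qed
  with \<open>(G \<longlongrightarrow> 0) at_infinity\<close> show ?case unfolding vanishing_holder.simps by blast
next
  case (Suc n G H)
  define A where "A x v = v + (\<Sum>j\<in>Basis. (v \<bullet> j) *\<^sub>R F j x)" for x v
  have Alin: "linear (A x)" for x
    by (rule linearI) (auto simp: A_def algebra_simps sum.distrib scaleR_sum_right)
  have Adiff: "A y v = A x v + (\<Sum>j\<in>Basis. (v \<bullet> j) *\<^sub>R (F j y - F j x))" for x y v
    by (simp add: A_def algebra_simps sum_subtractf)
  have low: "c * norm v \<le> norm (A x v)" for x v using lower by (simp add: A_def)
  have AG: "A x (G x) = H x" for x using Suc.prems(3) by (simp add: A_def)
  have F: "vh n (F j)" if "j \<in> Basis" for j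
    using Suc.prems(1)[OF that] by (rule vanishing_holder_SucD)
  have G: "vh n G"
    using Suc.IH[OF F vanishing_holder_SucD[OF Suc.prems(2)] Suc.prems(3)] by simp
  obtain H' where H': "\<And>x. (H has_derivative H' x) (at x)" "\<And>i. i \<in> Basis \<Longrightarrow> vh n (\<lambda>x. H' x i)"
    using vanishing_holder_SucE[OF Suc.prems(2)] by metis
  have "\<forall>j\<in>Basis. \<exists>F'. (\<forall>x. (F j has_derivative F' x) (at x)) \<and> (\<forall>i\<in>Basis. vh n (\<lambda>x. F' x i))"
    using vanishing_holder_SucE[OF Suc.prems(1)] by metis
  then obtain F' where F': "\<And>j x. j \<in> Basis \<Longrightarrow> (F j has_derivative F' j x) (at x)"
    "\<And>j i. j \<in> Basis \<Longrightarrow> i \<in> Basis \<Longrightarrow> vh n (\<lambda>x. F' j x i)"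
    by metis
  \<comment> \<open>Formal differentiation of \<open>A x (G x) = H x\<close> in direction
    \<open>h\<close>: the derivative of \<open>G\<close> should solve the same system with
    right-hand side \<open>q' x h\<close>.\<close>
  define q' where "q' x h = H' x h - (\<Sum>j\<in>Basis. (G x \<bullet> j) *\<^sub>R F' j x h)" for x h
  have "\<exists>L. (G has_derivative L) (at x) \<and> (\<forall>h. A x (L h) = q' x h)" for x
  proof -
    have "inj (A x)"
    proof (rule linear_injective_0[OF Alin, THEN iffD2], intro allI impI)
      fix v assume "A x v = 0"
      then show "v = 0" using low[of v x] c by (simp add: mult_le_0_iff)
    qed
    then obtain R where R: "linear R" "\<And>v. A x (R v) = v"
      using linear_injective_isomorphism[OF Alin] by metis
    \<comment> \<open>With \<open>G\<close> frozen at \<open>x\<close>, this is exactly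
      \<open>A y (G y - G x)\<close>, and its derivative at \<open>x\<close> is \<open>q' x\<close>.
      The candidate derivative of \<open>G\<close> is therefore the inverse of \<open>A x\<close>
      applied to \<open>q' x\<close>.\<close>
    define q where "q y = H y - H x - (\<Sum>j\<in>Basis. (G x \<bullet> j) *\<^sub>R (F j y - F j x))" for y
    have q: "(q has_derivative q' x) (at x)"
      unfolding q_def q'_def by (auto intro!: derivative_eq_intros F' H'(1))
    have qx: "q x = 0" by (simp add: q_def)
    define L where "L h = R (q' x h)" for h
    have Lbl: "bounded_linear L"
      unfolding L_def
      by (intro bounded_linear_compose[of R "q' x", unfolded o_def] has_derivative_bounded_linear[OF q])
        (simp add: R(1) linear_conv_bounded_linear[symmetric])
    then obtain K where K: "K \<ge> 0" "\<And>h. norm (L h) \<le> norm h * K"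
      using bounded_linear.nonneg_bounded by blast
    \<comment> \<open>Apply the lower bound at \<open>y\<close> to the linearization error. What
      remains is the error of \<open>q\<close>, plus the variation of \<open>F\<close> times the
      size of \<open>L\<close>; both tend to 0 after division by
      \<open>norm (y - x)\<close>.\<close>
    have bound: "norm (G y - G x - L (y - x)) / norm (y - x) \<le>
        (norm (q y - q x - q' x (y - x)) / norm (y - x) + (\<Sum>j\<in>Basis. K * norm (F j y - F j x))) / c"
      if "y \<noteq> x" for y
    proof -
      let ?h = "y - x"
      have "A y (G y - G x - L ?h) = q y - q x - q' x ?h - (\<Sum>j\<in>Basis. (L ?h \<bullet> j) *\<^sub>R (F j y - F j x))"
        using Adiff[of y "L ?h" x] Adiff[of y "G x" x]
        by (simp add: linear_diff[OF Alin] AG q_def L_def R)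
      then have "c * norm (G y - G x - L ?h) \<le>
         norm (q y - q x - q' x ?h - (\<Sum>j\<in>Basis. (L ?h \<bullet> j) *\<^sub>R (F j y - F j x)))"
        using low[of "G y - G x - L ?h" y] by simp
      also have "\<dots> \<le> norm (q y - q x - q' x ?h) + norm (\<Sum>j\<in>Basis. (L ?h \<bullet> j) *\<^sub>R (F j y - F j x))"
        by (rule norm_triangle_ineq4)
      also have "norm (\<Sum>j\<in>Basis. (L ?h \<bullet> j) *\<^sub>R (F j y - F j x)) \<le>
          (\<Sum>j\<in>Basis. norm ?h * (K * norm (F j y - F j x)))"
      proof (rule sum_norm_le)
        fix j :: 'b assume "j \<in> Basis"
        then have "\<bar>L ?h \<bullet> j\<bar> \<le> norm ?h * K"
          using Basis_le_norm K(2)[of ?h] order_trans by blast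
        then show "norm ((L ?h \<bullet> j) *\<^sub>R (F j y - F j x)) \<le> norm ?h * (K * norm (F j y - F j x))"
          using mult_right_mono[of "\<bar>L ?h \<bullet> j\<bar>" "norm ?h * K" "norm (F j y - F j x)"]
          by (simp add: mult.assoc)
      qed
      finally show ?thesis
        using that c by (simp add: field_simps sum_distrib_left[symmetric])
    qed
    have Fcont: "((\<lambda>y. norm (F j y - F j x)) \<longlongrightarrow> 0) (at x)" if "j \<in> Basis" for j
    proof -
      have "continuous (at x) (F j)" using F'(1)[OF that] has_derivative_continuous by blast
      then show ?thesis by (simp add: continuous_at tendsto_norm_zero LIM_zero)
    qed
    have "((\<lambda>y. (norm (q y - q x - q' x (y - x)) / norm (y - x) +
        (\<Sum>j\<in>Basis. K * norm (F j y - F j x))) / c) \<longlongrightarrow> (0 + (\<Sum>j\<in>(Basis::'b set). K * 0)) / c) (at x)"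
      using q c by (intro tendsto_intros Fcont) (auto simp: has_derivative_iff_norm)
    then have lim: "((\<lambda>y. (norm (q y - q x - q' x (y - x)) / norm (y - x) +
        (\<Sum>j\<in>Basis. K * norm (F j y - F j x))) / c) \<longlongrightarrow> 0) (at x)"
      by simp
    have "\<forall>\<^sub>F y in at x. norm (norm (G y - G x - L (y - x)) / norm (y - x)) \<le>
        (norm (q y - q x - q' x (y - x)) / norm (y - x) + (\<Sum>j\<in>Basis. K * norm (F j y - F j x))) / c"
      using bound by (simp add: eventually_at_filter)
    then have "((\<lambda>y. norm (G y - G x - L (y - x)) / norm (y - x)) \<longlongrightarrow> 0) (at x)"
      using lim by (rule Lim_null_comparison)
    then have "(G has_derivative L) (at x)" using Lbl by (simp add: has_derivative_iff_norm)
    then show ?thesis by (auto simp: L_def R)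
  qed
  then obtain L where L: "\<And>x. (G has_derivative L x) (at x)" "\<And>x h. A x (L x h) = q' x h" by metis
  show ?case
  proof (rule vanishing_holder_SucI)
    show "(G \<longlongrightarrow> 0) at_infinity" using G by (rule vanishing_holder_tendsto)
    show "(G has_derivative L x) (at x)" for x by (rule L)
    show "vh n (\<lambda>x. L x i)" if i: "i \<in> Basis" for i
    proof (rule Suc.IH[OF F])
      show "vh n (\<lambda>x. q' x i)"
        unfolding q'_def using H'(2) F'(2) G i
        by (intro vanishing_holder_diff vanishing_holder_sum vanishing_holder_scaleR
            vanishing_holder_inner) auto
      show "L x i + (\<Sum>j\<in>Basis. (L x i \<bullet> j) *\<^sub>R F j x) = q' x i" for x
        using L(2)[of x i] by (simp add: A_def)
    qed
  qed
qed

end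

section \<open>Comparison with iterated derivatives\<close>

definition basis_lists :: "nat \<Rightarrow> 'a::euclidean_space list set" where
  "basis_lists l = {bs. set bs \<subseteq> Basis \<and> length bs = l}"

lemma finite_basis_lists: "finite (basis_lists l)"
  unfolding basis_lists_def by (rule finite_lists_length_eq) simp

lemma sum_basis_lists_Suc:
  fixes h :: "'a::euclidean_space list \<Rightarrow> 'b::comm_monoid_add"
  shows "(\<Sum>bs\<in>basis_lists (Suc l). h bs) = (\<Sum>b\<in>Basis. \<Sum>bs\<in>basis_lists l. h (b # bs))"
proof -
  have "(basis_lists (Suc l) :: 'a list set) = (\<lambda>(b, bs). b # bs) ` (Basis \<times> basis_lists l)"
    by (force simp: basis_lists_def length_Suc_conv image_iff)
  moreover have "inj_on (\<lambda>(b, bs). b # bs) (Basis \<times> (basis_lists l :: 'a list set))"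
    by (auto simp: inj_on_def)
  ultimately have "(\<Sum>bs\<in>basis_lists (Suc l). h bs) = (\<Sum>(b, bs)\<in>Basis \<times> basis_lists l. h (b # bs))"
    by (simp only: sum.reindex o_def) (simp add: case_prod_unfold)
  then show ?thesis by (simp add: sum.cartesian_product)
qed

text \<open>Multilinearity in coordinates, proved from differentiability on basis tuples alone. The
  coefficients are chosen before \<open>x\<close>, so the same expansion serves for values,
  differences and continuity.\<close>

lemma nth_deriv_expand_basis:
  fixes f :: "'a::euclidean_space \<Rightarrow> 'b::real_normed_vector"
  assumes diff: "\<And>k bs x. k < n \<Longrightarrow> bs \<in> basis_lists k \<Longrightarrow> (\<lambda>y. nth_deriv k f y bs) differentiable (at x)"
    and "l \<le> n" "length vs = l"
  shows "\<exists>c. ((\<forall>v\<in>set vs. norm v \<le> 1) \<longrightarrow> (\<forall>bs\<in>basis_lists l. \<bar>c bs\<bar> \<le> 1)) \<and>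
      (\<forall>x. nth_deriv l f x vs = (\<Sum>bs\<in>basis_lists l. c bs *\<^sub>R nth_deriv l f x bs))"
  using assms(2,3)
proof (induction l arbitrary: vs)
  case 0
  have "basis_lists 0 = {[]::'a list}" by (auto simp: basis_lists_def)
  then show ?case by (intro exI[of _ "\<lambda>_. 1"]) simp
next
  case (Suc l)
  obtain v ws where vs: "vs = v # ws" "length ws = l" using Suc.prems by (cases vs) auto
  obtain c where "((\<forall>v\<in>set ws. norm v \<le> 1) \<longrightarrow> (\<forall>bs\<in>basis_lists l. \<bar>c bs\<bar> \<le> 1)) \<and>
      (\<forall>x. nth_deriv l f x ws = (\<Sum>bs\<in>basis_lists l. c bs *\<^sub>R nth_deriv l f x bs))"
    using Suc.IH[OF Suc_leD[OF Suc.prems(1)] vs(2)] ..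
  then have c: "(\<forall>v\<in>set ws. norm v \<le> 1) \<Longrightarrow> bs \<in> basis_lists l \<Longrightarrow> \<bar>c bs\<bar> \<le> 1"
    "nth_deriv l f x ws = (\<Sum>bs\<in>basis_lists l. c bs *\<^sub>R nth_deriv l f x bs)" for bs x
    by (rule conjE, blast)+
  \<comment> \<open>Coordinate of the head times the coefficient of the tail: the coefficients are
    products of coordinates, hence at most 1 for vectors in the unit ball.\<close>
  define d where "d = (\<lambda>bs. (v \<bullet> hd bs) * c (tl bs))"
  have "nth_deriv (Suc l) f x vs = (\<Sum>bs\<in>basis_lists (Suc l). d bs *\<^sub>R nth_deriv (Suc l) f x bs)" for x
  proof -
    let ?D = "\<lambda>bs. frechet_derivative (\<lambda>y. nth_deriv l f y bs) (at x)"
    have D: "((\<lambda>y. nth_deriv l f y bs) has_derivative ?D bs) (at x)" if "bs \<in> basis_lists l" for bs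
      using diff[OF _ that] Suc.prems by (simp add: frechet_derivative_works[symmetric])
    have "((\<lambda>y. nth_deriv l f y ws) has_derivative (\<lambda>h. \<Sum>bs\<in>basis_lists l. c bs *\<^sub>R ?D bs h)) (at x)"
      unfolding c(2) by (auto intro!: derivative_eq_intros D)
    then have "nth_deriv (Suc l) f x vs = (\<Sum>bs\<in>basis_lists l. c bs *\<^sub>R ?D bs v)"
      by (simp add: vs(1) frechet_derivative_eqI)
    also have "\<dots> = (\<Sum>bs\<in>basis_lists l. c bs *\<^sub>R (\<Sum>b\<in>Basis. (v \<bullet> b) *\<^sub>R ?D bs b))"
    proof (rule sum.cong[OF refl])
      fix bs :: "'a list" assume "bs \<in> basis_lists l"
      then have "linear (?D bs)" using D has_derivative_linear by blast
      then show "c bs *\<^sub>R ?D bs v = c bs *\<^sub>R (\<Sum>b\<in>Basis. (v \<bullet> b) *\<^sub>R ?D bs b)"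
        by (simp only: linear_expand_Basis[of "?D bs" v])
    qed
    also have "\<dots> = (\<Sum>b\<in>Basis. \<Sum>bs\<in>basis_lists l. d (b # bs) *\<^sub>R ?D bs b)"
      by (subst sum.swap) (simp add: scaleR_sum_right d_def mult.commute)
    finally show ?thesis by (simp add: sum_basis_lists_Suc)
  qed
  moreover have "\<bar>d bs\<bar> \<le> 1" if small: "\<forall>v\<in>set vs. norm v \<le> 1" "bs \<in> basis_lists (Suc l)" for bs
  proof -
    obtain b as where bs: "bs = b # as" "b \<in> Basis" "as \<in> basis_lists l"
      using small(2) by (cases bs) (auto simp: basis_lists_def)
    have "\<bar>v \<bullet> b\<bar> \<le> 1" using Basis_le_norm[OF bs(2), of v] small(1) vs by auto
    moreover have "\<bar>c as\<bar> \<le> 1" using c(1)[OF _ bs(3)] small(1) vs by auto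
    ultimately show ?thesis using mult_le_one[of "\<bar>v \<bullet> b\<bar>" "\<bar>c as\<bar>"] by (simp add: d_def bs abs_mult)
  qed
  ultimately show ?case by blast
qed

lemma opnorm_upper: "length vs = l \<Longrightarrow> \<forall>v\<in>set vs. norm v \<le> 1 \<Longrightarrow> ennreal (norm (T vs)) \<le> opnorm l T"
  unfolding opnorm_def by (rule SUP_upper) auto

text \<open>Clears the \<open>ennreal\<close> quotient; used to extract Hoelder constants and, for
  the discontinuity, to bound the seminorm from below.\<close>

lemma holder_seminorm_upper:
  assumes "length vs = n" "\<forall>v\<in>set vs. norm v \<le> 1" "x \<noteq> y"
  shows "ennreal (norm (nth_deriv n f x vs - nth_deriv n f y vs)) \<le>
     holder_seminorm n \<beta> f * ennreal (norm (x - y) powr \<beta>)"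
proof -
  let ?p = "ennreal (norm (x - y) powr \<beta>)"
  let ?X = "opnorm n (\<lambda>vs. nth_deriv n f x vs - nth_deriv n f y vs)"
  have "ennreal (norm (nth_deriv n f x vs - nth_deriv n f y vs)) \<le> ?X"
    using opnorm_upper[OF assms(1,2), of "\<lambda>vs. nth_deriv n f x vs - nth_deriv n f y vs"] by simp
  also have "?X = ?X / ?p * ?p"
    using assms(3) by (simp add: ennreal_divide_times ennreal_mult_divide_eq)
  also have "\<dots> \<le> holder_seminorm n \<beta> f * ?p"
    unfolding holder_seminorm_def using assms(3)
    by (intro mult_right_mono SUP_upper2[of "(x, y)"]) auto
  finally show ?thesis .
qed

context holder_exponent
begin

lemma C0_holder_imp_vanishing_holder:
  assumes "f \<in> C0_holder n \<beta>"
  shows "vh n f"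
proof -
  have C: "Cn_map n f" and lim: "\<And>l. l \<le> n \<Longrightarrow> ((\<lambda>x. opnorm l (nth_deriv l f x)) \<longlongrightarrow> 0) at_infinity"
    and fin: "holder_norm n \<beta> f < \<infinity>"
    using assms by (auto simp: C0_holder_def)
  have tend: "((\<lambda>x. nth_deriv l f x bs) \<longlongrightarrow> 0) at_infinity" if "l \<le> n" "bs \<in> basis_lists l" for l bs
  proof -
    have "((\<lambda>x. ennreal (norm (nth_deriv l f x bs))) \<longlongrightarrow> 0) at_infinity"
    proof (rule tendsto_sandwich[OF _ _ tendsto_const lim[OF that(1)]])
      have "ennreal (norm (nth_deriv l f x bs)) \<le> opnorm l (nth_deriv l f x)" for x
        by (rule opnorm_upper) (use that(2) in \<open>auto simp: basis_lists_def\<close>)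
      then show "\<forall>\<^sub>F x in at_infinity. ennreal (norm (nth_deriv l f x bs)) \<le> opnorm l (nth_deriv l f x)"
        by simp
    qed simp
    then have "((\<lambda>x. norm (nth_deriv l f x bs)) \<longlongrightarrow> 0) at_infinity"
      using tendsto_ennrealD[of "\<lambda>x. norm (nth_deriv l f x bs)" 0] by simp
    then show ?thesis by (rule tendsto_norm_zero_cancel)
  qed
  \<comment> \<open>Induction on the number \<open>k\<close> of derivatives still to be taken;
    \<open>k = n\<close> with the empty list is \<open>f\<close> itself.\<close>
  have "k \<le> n \<Longrightarrow> bs \<in> basis_lists (n - k) \<Longrightarrow> vh k (\<lambda>x. nth_deriv (n - k) f x bs)" for k bs
  proof (induction k arbitrary: bs)
    case 0
    have "holder_seminorm n \<beta> f < \<infinity>" using fin by (simp add: holder_norm_def)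
    then obtain C where C: "C \<ge> 0" "holder_seminorm n \<beta> f = ennreal C"
      by (cases "holder_seminorm n \<beta> f") auto
    have bs: "length bs = n" "\<forall>v\<in>set bs. norm v \<le> 1" using 0 by (auto simp: basis_lists_def)
    have "norm (nth_deriv n f x bs - nth_deriv n f y bs) \<le> C * norm (x - y) powr \<beta>" for x y
    proof (cases "x = y")
      case False
      then show ?thesis
        using holder_seminorm_upper[OF bs, of x y f \<beta>] C by (simp add: ennreal_mult[symmetric])
    qed simp
    then show ?case using tend[of n bs] 0 by auto
  next
    case (Suc k)
    have len: "length bs = n - Suc k" using Suc.prems by (simp add: basis_lists_def)
    have nk: "n - k = Suc (n - Suc k)" using Suc.prems by simp
    show ?case
      unfolding vanishing_holder.simps
    proof (intro conjI allI ballI)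
      show "((\<lambda>x. nth_deriv (n - Suc k) f x bs) \<longlongrightarrow> 0) at_infinity" using tend Suc.prems by simp
      show "(\<lambda>x. nth_deriv (n - Suc k) f x bs) differentiable (at x)" for x
        using C len Suc.prems unfolding Cn_map_def by auto
      fix i :: 'a assume i: "i \<in> Basis"
      have "vh k (\<lambda>x. nth_deriv (n - k) f x (i # bs))"
        using i Suc.prems nk by (intro Suc.IH) (auto simp: basis_lists_def)
      then show "vh k (\<lambda>x. frechet_derivative (\<lambda>x. nth_deriv (n - Suc k) f x bs) (at x) i)"
        by (simp add: nk)
    qed
  qed
  from this[of n "[]"] show ?thesis by (simp add: basis_lists_def)
qed

lemma vanishing_holder_nth_deriv:
  assumes "vh n f" "l \<le> n" "bs \<in> basis_lists l"
  shows "vh (n - l) (\<lambda>x. nth_deriv l f x bs)"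
  using assms(2,3)
proof (induction l arbitrary: bs)
  case 0
  then show ?case using assms(1) by simp
next
  case (Suc l)
  obtain b as where bs: "bs = b # as" "b \<in> Basis" "as \<in> basis_lists l"
    using Suc.prems by (cases bs) (auto simp: basis_lists_def)
  have "n - l = Suc (n - Suc l)" using Suc.prems by simp
  then have "vh (Suc (n - Suc l)) (\<lambda>x. nth_deriv l f x as)"
    using Suc.IH[OF _ bs(3)] Suc.prems by simp
  then show ?case using bs by simp
qed

text \<open>There are finitely many basis tuples, and the coefficients on the unit ball are at most
  1. Hence every operator norm is dominated by a finite sum of norms of iterated partial
  derivatives, which inherits decay, bounds and Hoelder constants.\<close>

lemma vanishing_holder_imp_C0_holder:
  fixes f :: "'a::euclidean_space \<Rightarrow> 'b::euclidean_space"
  assumes "vh n f"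
  shows "f \<in> C0_holder n \<beta>"
proof -
  note N = vanishing_holder_nth_deriv[OF assms]
  have diff: "(\<lambda>y. nth_deriv l f y bs) differentiable (at x)"
    if "l < n" "bs \<in> basis_lists l" for l bs x
  proof -
    have "n - l = Suc (n - Suc l)" using that by simp
    then show ?thesis using N[of l bs] that by simp
  qed
  note expand = nth_deriv_expand_basis[of n f, OF diff]
  have sum_diff: "(\<lambda>x. \<Sum>i\<in>A. g i x) differentiable (at y)"
    if "finite A" "\<And>i. i \<in> A \<Longrightarrow> g i differentiable (at y)" for A and g :: "'a list \<Rightarrow> 'a \<Rightarrow> 'b" and y
    using that by (induction A) auto
  have Cn: "Cn_map n f"
    unfolding Cn_map_def
  proof (intro conjI allI impI)
    fix l x and vs :: "'a list" assume l: "l < n" "length vs = l"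
    obtain c where "(\<lambda>x. nth_deriv l f x vs) = (\<lambda>x. \<Sum>bs\<in>basis_lists l. c bs *\<^sub>R nth_deriv l f x bs)"
      using expand[of l vs] l by (metis less_imp_le)
    then show "(\<lambda>y. nth_deriv l f y vs) differentiable (at x)"
      using diff[OF l(1)] by (auto intro!: sum_diff finite_basis_lists differentiable_scaleR)
  next
    fix l and vs :: "'a list" assume l: "l \<le> n" "length vs = l"
    obtain c where "(\<lambda>x. nth_deriv l f x vs) = (\<lambda>x. \<Sum>bs\<in>basis_lists l. c bs *\<^sub>R nth_deriv l f x bs)"
      using expand[of l vs] l by metis
    then show "continuous_on UNIV (\<lambda>y. nth_deriv l f y vs)"
      by (simp only:) (intro continuous_on_sum continuous_on_scaleR continuous_on_const
          vanishing_holder_continuous[OF N[OF l(1)]])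
  qed
  have le: "norm (nth_deriv l f x vs) \<le> (\<Sum>bs\<in>basis_lists l. norm (nth_deriv l f x bs))"
    and le2: "norm (nth_deriv l f x vs - nth_deriv l f y vs) \<le>
      (\<Sum>bs\<in>basis_lists l. norm (nth_deriv l f x bs - nth_deriv l f y bs))"
    if lv: "l \<le> n" "length vs = l" "\<forall>v\<in>set vs. norm v \<le> 1" for l vs x y
  proof -
    obtain c where "((\<forall>v\<in>set vs. norm v \<le> 1) \<longrightarrow> (\<forall>bs\<in>basis_lists l. \<bar>c bs\<bar> \<le> 1)) \<and>
      (\<forall>x. nth_deriv l f x vs = (\<Sum>bs\<in>basis_lists l. c bs *\<^sub>R nth_deriv l f x bs))"
      using expand[OF _ _ lv(1,2)] by auto
    then have c: "\<And>bs. bs \<in> basis_lists l \<Longrightarrow> \<bar>c bs\<bar> \<le> 1"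
      "\<And>x. nth_deriv l f x vs = (\<Sum>bs\<in>basis_lists l. c bs *\<^sub>R nth_deriv l f x bs)"
      using lv(3) by auto
    show "norm (nth_deriv l f x vs) \<le> (\<Sum>bs\<in>basis_lists l. norm (nth_deriv l f x bs))"
      unfolding c(2) using c(1) by (intro sum_norm_le) (simp add: mult_left_le_one_le)
    have "nth_deriv l f x vs - nth_deriv l f y vs =
        (\<Sum>bs\<in>basis_lists l. c bs *\<^sub>R (nth_deriv l f x bs - nth_deriv l f y bs))"
      unfolding c(2) by (simp add: sum_subtractf scaleR_diff_right)
    then show "norm (nth_deriv l f x vs - nth_deriv l f y vs) \<le>
      (\<Sum>bs\<in>basis_lists l. norm (nth_deriv l f x bs - nth_deriv l f y bs))"
      using c(1) by (auto intro!: sum_norm_le simp: mult_left_le_one_le)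
  qed
  have op: "opnorm l (nth_deriv l f x) \<le> ennreal (\<Sum>bs\<in>basis_lists l. norm (nth_deriv l f x bs))"
    if "l \<le> n" for l x
    unfolding opnorm_def using le that by (intro SUP_least ennreal_leI) auto
  have lim: "((\<lambda>x. opnorm l (nth_deriv l f x)) \<longlongrightarrow> 0) at_infinity" if l: "l \<le> n" for l
  proof (rule tendsto_sandwich[OF _ _ tendsto_const])
    have "((\<lambda>x. \<Sum>bs\<in>basis_lists l. norm (nth_deriv l f x bs)) \<longlongrightarrow> (\<Sum>bs\<in>(basis_lists l::'a list set). 0)) at_infinity"
      using N[OF l] by (intro tendsto_sum tendsto_norm_zero) (rule vanishing_holder_tendsto)
    then show "((\<lambda>x. ennreal (\<Sum>bs\<in>basis_lists l. norm (nth_deriv l f x bs))) \<longlongrightarrow> 0) at_infinity"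
      using tendsto_ennrealI by force
  qed (use op[OF l] in auto)
  have "\<exists>B. \<forall>x. opnorm l (nth_deriv l f x) \<le> ennreal B" if l: "l \<le> n" for l
  proof -
    have "\<forall>bs\<in>basis_lists l. \<exists>B. \<forall>x. norm (nth_deriv l f x bs) \<le> B"
      using vanishing_holder_bounded[OF N[OF l]] by metis
    then obtain B where "\<And>bs x. bs \<in> basis_lists l \<Longrightarrow> norm (nth_deriv l f x bs) \<le> B bs" by metis
    then have "ennreal (\<Sum>bs\<in>basis_lists l. norm (nth_deriv l f x bs)) \<le> ennreal (\<Sum>bs\<in>basis_lists l. B bs)" for x
      by (intro ennreal_leI sum_mono)
    then show ?thesis using op[OF l] order_trans by blast
  qed
  then obtain B where B: "\<And>l x. l \<le> n \<Longrightarrow> opnorm l (nth_deriv l f x) \<le> ennreal (B l)" by metis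
  have "Cn_norm n f \<le> ennreal (Max (B ` {..n}))"
    unfolding Cn_norm_def
  proof (rule SUP_least, clarify)
    fix l x assume "l \<le> n"
    then have "ennreal (B l) \<le> ennreal (Max (B ` {..n}))" by (intro ennreal_leI Max_ge) auto
    then show "opnorm l (nth_deriv l f x) \<le> ennreal (Max (B ` {..n}))"
      using B[OF \<open>l \<le> n\<close>] order_trans by blast
  qed
  then have fin1: "Cn_norm n f < \<infinity>" by (simp add: order_le_less_trans)
  have "\<forall>bs\<in>basis_lists n. \<exists>C. \<forall>x y. norm (nth_deriv n f x bs - nth_deriv n f y bs) \<le> C * norm (x - y) powr \<beta>"
    using N[of n] by auto
  then obtain C where C: "\<And>bs x y. bs \<in> basis_lists n \<Longrightarrow>
      norm (nth_deriv n f x bs - nth_deriv n f y bs) \<le> C bs * norm (x - y) powr \<beta>" by metis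
  have "holder_seminorm n \<beta> f \<le> ennreal (\<Sum>bs\<in>basis_lists n. C bs)"
    unfolding holder_seminorm_def
  proof (rule SUP_least, clarify)
    fix x y :: 'a assume "x \<noteq> y"
    let ?p = "norm (x - y) powr \<beta>"
    have p: "?p > 0" using \<open>x \<noteq> y\<close> by simp
    have "norm (nth_deriv n f x vs - nth_deriv n f y vs) \<le> (\<Sum>bs\<in>basis_lists n. C bs) * ?p"
      if "length vs = n" "\<forall>v\<in>set vs. norm v \<le> 1" for vs
    proof -
      have "norm (nth_deriv n f x vs - nth_deriv n f y vs) \<le> (\<Sum>bs\<in>basis_lists n. C bs * ?p)"
        using le2[OF _ that, of x y] C[of _ x y] by (intro order_trans[OF le2[OF _ that] sum_mono]) auto
      then show ?thesis by (simp add: sum_distrib_right)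
    qed
    then have "opnorm n (\<lambda>vs. nth_deriv n f x vs - nth_deriv n f y vs) \<le>
       ennreal ((\<Sum>bs\<in>basis_lists n. C bs) * ?p)"
      unfolding opnorm_def by (intro SUP_least ennreal_leI) auto
    also have "\<dots> = ennreal (\<Sum>bs\<in>basis_lists n. C bs) * ennreal ?p"
      using p by (simp add: ennreal_mult'')
    finally show "opnorm n (\<lambda>vs. nth_deriv n f x vs - nth_deriv n f y vs) / ennreal ?p \<le>
        ennreal (\<Sum>bs\<in>basis_lists n. C bs)"
      using p by (intro divide_le_posI_ennreal) (auto simp: mult.commute)
  qed
  then have "holder_seminorm n \<beta> f < \<infinity>" by (simp add: order_le_less_trans)
  with fin1 Cn lim show ?thesis by (auto simp: C0_holder_def holder_norm_def)
qed

lemma C0_holder_iff_vanishing_holder: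
  fixes f :: "'a::euclidean_space \<Rightarrow> 'b::euclidean_space"
  shows "f \<in> C0_holder n \<beta> \<longleftrightarrow> vh n f"
  using C0_holder_imp_vanishing_holder vanishing_holder_imp_C0_holder by blast


section \<open>Inverses and the group structure\<close>

text \<open>The operator norm is at most the sum of the column norms, so decay and continuity of the
  columns carry over to decay and continuity in operator norm.\<close>

lemma vanishing_holder_derivative_onorm:
  fixes f :: "'a::euclidean_space \<Rightarrow> 'b::real_normed_vector"
  assumes "vh (Suc n) f" and f': "\<And>x. (f has_derivative f' x) (at x)"
  shows "\<And>i. i \<in> Basis \<Longrightarrow> vh n (\<lambda>x. f' x i)"
    and "((\<lambda>x. onorm (f' x)) \<longlongrightarrow> 0) at_infinity"
    and "((\<lambda>x. onorm (\<lambda>v. f' x v - f' a v)) \<longlongrightarrow> 0) (at a)"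
proof -
  have lin: "linear (f' x)" for x using f' has_derivative_linear by blast
  have le: "onorm T \<le> (\<Sum>j\<in>Basis. norm (T j))" if "linear T" for T :: "'a \<Rightarrow> 'b"
  proof (rule onorm_le)
    fix v :: 'a
    have "norm (T v) = norm (\<Sum>j\<in>Basis. (v \<bullet> j) *\<^sub>R T j)"
      using linear_expand_Basis[OF that, of v] by simp
    also have "\<dots> \<le> (\<Sum>j\<in>Basis. norm v * norm (T j))"
      by (intro sum_norm_le) (auto intro!: mult_right_mono simp: Basis_le_norm)
    finally show "norm (T v) \<le> (\<Sum>j\<in>Basis. norm (T j)) * norm v"
      by (simp add: sum_distrib_left mult.commute)
  qed
  have nn: "0 \<le> onorm T" if "linear T" for T :: "'a \<Rightarrow> 'b"
    using that by (simp add: onorm_pos_le linear_conv_bounded_linear[symmetric])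
  show vh: "vh n (\<lambda>x. f' x i)" if "i \<in> Basis" for i
    using assms that frechet_derivative_eqI[OF f'] by simp
  have "((\<lambda>x. \<Sum>j\<in>Basis. norm (f' x j)) \<longlongrightarrow> (\<Sum>j\<in>(Basis::'a set). 0)) at_infinity"
    using vh by (intro tendsto_sum tendsto_norm_zero) (rule vanishing_holder_tendsto)
  then show "((\<lambda>x. onorm (f' x)) \<longlongrightarrow> 0) at_infinity"
    using le[OF lin] nn[OF lin] by (intro Lim_null_comparison[of "\<lambda>x. onorm (f' x)"]) auto
  have lin2: "linear (\<lambda>v. f' x v - f' a v)" for x using lin by (intro linear_compose_sub)
  have "((\<lambda>x. \<Sum>j\<in>Basis. norm (f' x j - f' a j)) \<longlongrightarrow> (\<Sum>j\<in>(Basis::'a set). 0)) (at a)"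
  proof (intro tendsto_sum tendsto_norm_zero LIM_zero)
    fix j :: 'a assume "j \<in> Basis"
    from vanishing_holder_continuous[OF vh[OF this]] show "((\<lambda>x. f' x j) \<longlongrightarrow> f' a j) (at a)"
      by (simp add: continuous_on_def)
  qed
  then show "((\<lambda>x. onorm (\<lambda>v. f' x v - f' a v)) \<longlongrightarrow> 0) (at a)"
    using le[OF lin2] nn[OF lin2]
    by (intro Lim_null_comparison[of "\<lambda>x. onorm (\<lambda>v. f' x v - f' a v)"]) auto
qed

text \<open>Far out \<open>f' x\<close> has norm below 1/2, which gives the constant 1/2. On the
  remaining ball the norm of \<open>v + f' x v\<close> attains a positive minimum over unit vectors
  by compactness.\<close>

lemma nonsingular_lower_bound:
  fixes f :: "'a::euclidean_space \<Rightarrow> 'a"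
  assumes vf: "vh (Suc n) f" and f': "\<And>x. (f has_derivative f' x) (at x)"
    and ns: "\<And>x v. v + f' x v = 0 \<Longrightarrow> v = 0"
  obtains c where "c > 0" "\<And>x v. c * norm v \<le> norm (v + f' x v)"
proof -
  note D = vanishing_holder_derivative_onorm[OF vf f']
  have bl: "bounded_linear (f' x)" for x using f' has_derivative_bounded_linear by blast
  have lin: "linear (f' x)" for x using f' has_derivative_linear by blast
  have "eventually (\<lambda>x. onorm (f' x) < 1/2) at_infinity"
    using order_tendstoD(2)[OF D(2), of "1/2"] by simp
  then obtain R0 where R0: "\<And>x. R0 \<le> norm x \<Longrightarrow> onorm (f' x) < 1/2"
    by (auto simp: eventually_at_infinity)
  \<comment> \<open>A nonnegative radius keeps the ball nonempty, as the existence of a minimum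
    requires.\<close>
  define R where "R = max R0 0"
  have cont: "continuous_on S (\<lambda>p. norm (snd p + f' (fst p) (snd p)))" for S
  proof -
    have eq: "f' x v = (\<Sum>j\<in>Basis. (v \<bullet> j) *\<^sub>R f' x j)" for x v
      by (rule linear_expand_Basis[OF lin])
    have "continuous_on UNIV (\<lambda>p. norm (snd p + (\<Sum>j\<in>Basis. (snd p \<bullet> j) *\<^sub>R f' (fst p) j)))"
      by (intro continuous_intros continuous_on_compose2[OF vanishing_holder_continuous[OF D(1)]]) auto
    then show ?thesis unfolding eq[symmetric] by (rule continuous_on_subset) simp
  qed
  have "compact (cball (0::'a) R \<times> sphere (0::'a) 1)"
    by (intro compact_Times) auto
  moreover have "cball (0::'a) R \<times> sphere (0::'a) 1 \<noteq> {}"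
    using vector_choose_size[of 1, where 'a = 'a] by (auto simp: R_def)
  ultimately obtain p where p: "p \<in> cball 0 R \<times> sphere 0 1"
    and min: "\<And>q. q \<in> cball 0 R \<times> sphere 0 1 \<Longrightarrow>
        norm (snd p + f' (fst p) (snd p)) \<le> norm (snd q + f' (fst q) (snd q))"
    using continuous_attains_inf[OF _ _ cont] by metis
  define m where "m = norm (snd p + f' (fst p) (snd p))"
  have "m > 0" using ns[of "snd p" "fst p"] p by (auto simp: m_def)
  have "min m (1/2) * norm v \<le> norm (v + f' x v)" for x v
  proof (cases "norm x \<le> R")
    case True
    show ?thesis
    proof (cases "v = 0")
      case False
      have "m \<le> norm (v /\<^sub>R norm v + f' x (v /\<^sub>R norm v))"
        using min[of "(x, v /\<^sub>R norm v)"] True False by (simp add: m_def)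
      also have "\<dots> = norm ((v + f' x v) /\<^sub>R norm v)"
        by (simp add: linear_scale[OF lin] scaleR_add_right)
      also have "\<dots> = norm (v + f' x v) / norm v" by (simp add: divide_inverse_commute)
      finally have "m * norm v \<le> norm (v + f' x v)" using False by (simp add: field_simps)
      moreover have "min m (1/2) * norm v \<le> m * norm v" by (intro mult_right_mono) auto
      ultimately show ?thesis by linarith
    qed simp
  next
    case False
    then have "onorm (f' x) < 1/2" using R0 by (simp add: R_def)
    then have "norm (f' x v) \<le> 1/2 * norm v"
      using onorm[OF bl, of x v] mult_right_mono[of "onorm (f' x)" "1/2" "norm v"] by simp
    moreover have "norm v \<le> norm (v + f' x v) + norm (f' x v)"
      using norm_triangle_ineq4[of "v + f' x v" "f' x v"] by simp
    moreover have "min m (1/2) * norm v \<le> 1/2 * norm v" by (intro mult_right_mono) auto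
    ultimately show ?thesis by linarith
  qed
  moreover have "min m (1/2) > 0" using \<open>m > 0\<close> by simp
  ultimately show ?thesis using that by blast
qed

text \<open>
  The set of points with at least two preimages under \<open>id + f\<close> is open because \<open>id + f\<close> is an open
  map, and closed because \<open>id + f\<close> is proper and locally injective. It misses all points far out,
  where \<open>f\<close> is a contraction, so it is empty.
\<close>

lemma nonsingular_inj:
  fixes f :: "'a::euclidean_space \<Rightarrow> 'a"
  assumes vf: "vh (Suc n) f" and f': "\<And>x. (f has_derivative f' x) (at x)"
    and ns: "\<And>x v. v + f' x v = 0 \<Longrightarrow> v = 0"
  shows "inj (\<lambda>x. x + f x)"
proof -
  define \<Phi> where "\<Phi> = (\<lambda>x. x + f x)"
  define A where "A x v = v + f' x v" for x v
  note D = vanishing_holder_derivative_onorm[OF vf f']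
  have der: "(\<Phi> has_derivative A x) (at x)" for x
    unfolding \<Phi>_def A_def by (intro derivative_intros f')
  have cont: "continuous_on UNIV \<Phi>"
    by (rule has_derivative_continuous_on[of _ _ A]) (use der in simp)
  have lin: "linear (A x)" for x using der has_derivative_linear by blast
  have inv: "\<exists>R. bounded_linear R \<and> R \<circ> A x = id \<and> A x \<circ> R = id" for x
  proof -
    have "inj (A x)" unfolding linear_injective_0[OF lin] using ns unfolding A_def by blast
    then obtain R where "linear R" "\<And>v. R (A x v) = v" "\<And>v. A x (R v) = v"
      using linear_injective_isomorphism[OF lin] by metis
    then show ?thesis by (auto simp: linear_conv_bounded_linear fun_eq_iff)
  qed
  obtain M where M: "M > 0" "\<And>x. norm (f x) \<le> M" using vanishing_holder_bounded[OF vf] by metis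
  define U where "U = {y. \<exists>a b. a \<noteq> b \<and> \<Phi> a = y \<and> \<Phi> b = y}"
  have "open U"
  proof (subst open_subopen, intro ballI)
    fix y assume "y \<in> U"
    then obtain a b where ab: "a \<noteq> b" "\<Phi> a = y" "\<Phi> b = y" by (auto simp: U_def)
    then obtain S T where ST: "open S" "open T" "a \<in> S" "b \<in> T" "S \<inter> T = {}"
      using hausdorff by metis
    \<comment> \<open>Openness of the map at points with invertible derivative: the images of
      disjoint neighbourhoods of \<open>a\<close> and \<open>b\<close> overlap in a neighbourhood of
      \<open>y\<close> whose points all have two preimages.\<close>
    have "\<Phi> x \<in> interior (\<Phi> ` V)" if "open V" "x \<in> V" for x V
      using inv[of x] that cont der
      by (metis UNIV_I interior_open open_UNIV subset_UNIV sussmann_open_mapping)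
    then have "y \<in> interior (\<Phi> ` S) \<inter> interior (\<Phi> ` T)" using ST ab by fastforce
    moreover have "interior (\<Phi> ` S) \<inter> interior (\<Phi> ` T) \<subseteq> U"
    proof
      fix z assume "z \<in> interior (\<Phi> ` S) \<inter> interior (\<Phi> ` T)"
      then have "z \<in> \<Phi> ` S" "z \<in> \<Phi> ` T" using interior_subset by blast+
      then obtain s t where "s \<in> S" "t \<in> T" "\<Phi> s = z" "\<Phi> t = z" by (metis imageE)
      moreover from this have "s \<noteq> t" using ST(5) by blast
      ultimately show "z \<in> U" unfolding U_def by blast
    qed
    ultimately show "\<exists>T. open T \<and> y \<in> T \<and> T \<subseteq> U"
      by (intro exI[of _ "interior (\<Phi> ` S) \<inter> interior (\<Phi> ` T)"]) auto
  qed
  moreover have "closed U"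
    unfolding closed_sequential_limits
  proof (intro allI impI)
    fix y l assume "(\<forall>k. y k \<in> U) \<and> y \<longlonglongrightarrow> l"
    then have yU: "\<forall>k. \<exists>a b. a \<noteq> b \<and> \<Phi> a = y k \<and> \<Phi> b = y k" and yl: "y \<longlonglongrightarrow> l"
      by (auto simp: U_def)
    then obtain a b where ab: "\<And>k. a k \<noteq> b k" "\<And>k. \<Phi> (a k) = y k" "\<And>k. \<Phi> (b k) = y k"
      by metis
    obtain Y where Y: "\<And>k. norm (y k) \<le> Y"
      using convergent_imp_bounded[OF yl] by (auto simp: bounded_iff)
    \<comment> \<open>Properness: \<open>f\<close> is bounded by \<open>M\<close>, so preimages of a
      bounded sequence stay bounded and both preimage sequences have a common convergent
      subsequence.\<close>
    have bd: "norm x \<le> Y + M" if "\<Phi> x = y k" for x k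
      using norm_triangle_ineq4[of "\<Phi> x" "f x"] M(2)[of x] Y[of k] that by (simp add: \<Phi>_def)
    have cpt: "compact (cball (0::'a) (Y + M) \<times> cball (0::'a) (Y + M))" by (intro compact_Times) auto
    have mem: "\<forall>k. (a k, b k) \<in> cball 0 (Y + M) \<times> cball 0 (Y + M)" using bd ab by auto
    obtain p r where "p \<in> cball 0 (Y + M) \<times> cball 0 (Y + M)" and r: "strict_mono r"
      and p: "((\<lambda>k. (a k, b k)) \<circ> r) \<longlonglongrightarrow> p"
      by (rule seq_compactE[OF compact_imp_seq_compact[OF cpt] mem])
    have al: "(\<lambda>k. a (r k)) \<longlonglongrightarrow> fst p" and bl: "(\<lambda>k. b (r k)) \<longlonglongrightarrow> snd p"
      using tendsto_fst[OF p] tendsto_snd[OF p] by (simp_all add: o_def)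
    have yr: "(\<lambda>k. y (r k)) \<longlonglongrightarrow> l" using LIMSEQ_subseq_LIMSEQ[OF yl r] by (simp add: o_def)
    have "(\<lambda>k. \<Phi> (a (r k))) \<longlonglongrightarrow> \<Phi> (fst p)" "(\<lambda>k. \<Phi> (b (r k))) \<longlonglongrightarrow> \<Phi> (snd p)"
      using continuous_on_tendsto_compose[OF cont al] continuous_on_tendsto_compose[OF cont bl] by auto
    then have \<Phi>p: "\<Phi> (fst p) = l" "\<Phi> (snd p) = l"
      using LIMSEQ_unique[OF yr] unfolding ab by metis+
    \<comment> \<open>If the two limits coincided, \<open>a (r k)\<close> and \<open>b (r k)\<close>
      would eventually be distinct points with equal image inside a ball on which the map is
      injective. Local injectivity rests on the continuity of the derivative in operator
      norm.\<close>
    have "fst p \<noteq> snd p"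
    proof
      assume eq: "fst p = snd p"
      obtain R where R: "bounded_linear R" "R \<circ> A (fst p) = id" using inv by blast
      have "\<exists>d>0. \<forall>x. dist (fst p) x < d \<longrightarrow> onorm (\<lambda>v. A x v - A (fst p) v) < e" if "e > 0" for e
      proof -
        have e: "onorm (\<lambda>v. A (fst p) v - A (fst p) v) < e" using that by (simp add: onorm_zero)
        have "eventually (\<lambda>x. onorm (\<lambda>v. A x v - A (fst p) v) < e) (at (fst p))"
          using order_tendstoD(2)[OF D(3) that] by (simp add: A_def)
        then obtain d where "d > 0"
          "\<And>x. x \<noteq> fst p \<Longrightarrow> dist x (fst p) < d \<Longrightarrow> onorm (\<lambda>v. A x v - A (fst p) v) < e"
          by (auto simp: eventually_at)
        then show ?thesis using e by (metis dist_commute)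
      qed
      then obtain \<rho> where \<rho>: "\<rho> > 0" "inj_on \<Phi> (ball (fst p) \<rho>)"
        using has_derivative_locally_injective[OF UNIV_I open_UNIV R der] by metis
      have "eventually (\<lambda>k. a (r k) \<in> ball (fst p) \<rho>) sequentially"
        "eventually (\<lambda>k. b (r k) \<in> ball (fst p) \<rho>) sequentially"
        using topological_tendstoD[OF al open_ball, of "fst p" \<rho>]
          topological_tendstoD[OF bl open_ball, of "fst p" \<rho>] \<rho>(1) eq by auto
      then have "eventually (\<lambda>k. False) sequentially"
      proof eventually_elim
        case (elim k)
        then show ?case using inj_onD[OF \<rho>(2), of "a (r k)" "b (r k)"] ab by simp
      qed
      then show False by simp
    qed
    then show "l \<in> U" using \<Phi>p by (auto simp: U_def)
  qed
  moreover have "U \<noteq> UNIV"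
  proof -
    have "eventually (\<lambda>x. onorm (f' x) < 1/2) at_infinity"
      using order_tendstoD(2)[OF D(2), of "1/2"] by simp
    then obtain R where R: "\<And>x. R \<le> norm x \<Longrightarrow> onorm (f' x) < 1/2"
      by (auto simp: eventually_at_infinity)
    \<comment> \<open>Every preimage of \<open>y\<close> lies within \<open>M\<close> of
      \<open>y\<close>, so this norm forces all of them into the region where \<open>f'\<close> has
      norm below 1/2; two preimages there must agree.\<close>
    obtain y :: 'a where y: "norm y = \<bar>R\<bar> + M" using vector_choose_size[of "\<bar>R\<bar> + M"] M(1) by auto
    have "a = b" if "\<Phi> a = y" "\<Phi> b = y" for a b
    proof -
      have "x \<in> cball y M" if "\<Phi> x = y" for x using that M(2) by (auto simp: \<Phi>_def dist_norm)
      then have in_ball: "a \<in> cball y M" "b \<in> cball y M" using that by auto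
      have "norm (f a - f b) \<le> 1/2 * norm (a - b)"
      proof (rule differentiable_bound[OF convex_cball[of y M] _ _ in_ball])
        show "(f has_derivative f' x) (at x within cball y M)" for x
          using f' has_derivative_at_withinI by blast
        fix x assume "x \<in> cball y M"
        then have "R \<le> norm x"
          using norm_triangle_ineq2[of y x] y by (simp add: dist_norm)
        then show "onorm (f' x) \<le> 1/2" using R by fastforce
      qed
      moreover have "a - b = f b - f a" using that by (simp add: \<Phi>_def algebra_simps)
      ultimately have "norm (a - b) \<le> 1/2 * norm (a - b)" by (simp add: norm_minus_commute)
      then show "a = b" by simp
    qed
    then have "y \<notin> U" by (auto simp: U_def)
    then show ?thesis by auto
  qed
  ultimately have "U = {}" using clopen by blast
  then have "\<Phi> a = \<Phi> b \<Longrightarrow> a = b" for a b unfolding U_def by blast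
  then have "inj \<Phi>" by (rule injI)
  then show ?thesis by (simp only: \<Phi>_def)
qed

text \<open>A preimage of \<open>y\<close> is a fixed point of \<open>\<lambda>x. y - f x\<close>,
  which maps the ball of radius \<open>M\<close> around \<open>y\<close> into itself.\<close>

lemma add_bounded_surj:
  fixes f :: "'a::euclidean_space \<Rightarrow> 'a"
  assumes "continuous_on UNIV f" "\<And>x. norm (f x) \<le> M"
  shows "surj (\<lambda>x. x + f x)"
proof -
  have M: "0 \<le> M" using assms(2) norm_ge_zero order_trans by blast
  have "\<exists>x. y = x + f x" for y
  proof -
    have "continuous_on (cball y M) (\<lambda>x. y - f x)"
      by (intro continuous_intros continuous_on_subset[OF assms(1)]) auto
    then obtain x where "y - f x = x"
      using brouwer[of "cball y M" "\<lambda>x. y - f x"] assms(2) M by (auto simp: dist_norm)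
    then show ?thesis by (metis diff_add_cancel)
  qed
  then show ?thesis by (simp add: surj_def)
qed

text \<open>Bootstrapping: if \<open>k\<close> has level \<open>m\<close>, so do the columns of
  \<open>f'\<close> along the inverse, by composition. The derivative of \<open>k\<close> solves a
  linear system with these coefficients, so it has level \<open>m\<close> and \<open>k\<close> has
  level \<open>m + 1\<close>.\<close>

lemma vanishing_holder_inverse:
  fixes f :: "'a::euclidean_space \<Rightarrow> 'a"
  assumes vf: "vh (Suc n) f" and f': "\<And>x. (f has_derivative f' x) (at x)"
    and ns: "\<And>x v. v + f' x v = 0 \<Longrightarrow> v = 0"
  obtains k where "vh (Suc n) k" "\<And>x. (x + f x) + k (x + f x) = x"
    "\<And>y. (y + k y) + f (y + k y) = y"
proof -
  define \<Phi> where "\<Phi> = (\<lambda>x. x + f x)"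
  define A where "A x v = v + f' x v" for x v
  note D = vanishing_holder_derivative_onorm[OF vf f']
  have der: "(\<Phi> has_derivative A x) (at x)" for x
    unfolding \<Phi>_def A_def by (intro derivative_intros f')
  have lin: "linear (A x)" for x using der has_derivative_linear by blast
  obtain c where c: "c > 0" "\<And>x v. c * norm v \<le> norm (A x v)"
    unfolding A_def using nonsingular_lower_bound[OF vf f'] ns by blast
  have "\<exists>R. linear R \<and> (\<forall>v. A x (R v) = v)" for x
  proof -
    have "inj (A x)" unfolding linear_injective_0[OF lin] using ns unfolding A_def by blast
    then show ?thesis using linear_injective_isomorphism[OF lin] by metis
  qed
  then obtain R where R: "\<And>x. linear (R x)" "\<And>x v. A x (R x v) = v" by metis
  obtain M where M: "M > 0" "\<And>x. norm (f x) \<le> M" using vanishing_holder_bounded[OF vf] by metis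
  have "inj \<Phi>" unfolding \<Phi>_def by (rule nonsingular_inj[OF vf f' ns])
  moreover have "surj \<Phi>"
    unfolding \<Phi>_def using add_bounded_surj[OF vanishing_holder_continuous[OF vf] M(2)] .
  ultimately obtain \<Psi> where \<Psi>: "\<And>x. \<Psi> (\<Phi> x) = x" "\<And>y. \<Phi> (\<Psi> y) = y"
    by (metis inv_f_f surj_f_inv_f)
  define k where "k y = \<Psi> y - y" for y
  have kf: "k y = - f (\<Psi> y)" for y
    using \<Psi>(2)[of y] by (simp add: k_def \<Phi>_def algebra_simps)
  have kM: "norm (k y) \<le> M" for y by (simp add: kf M)
  have \<Psi>k: "\<Psi> y = y + k y" for y by (simp add: k_def)
  have der\<Psi>: "(\<Psi> has_derivative R (\<Psi> y)) (at y)" for y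
  proof -
    have "(\<Psi> has_derivative R (\<Psi> y)) (at (\<Phi> (\<Psi> y)))"
      by (rule has_derivative_inverse_on[where S = UNIV and f' = A, OF open_UNIV der \<Psi>(1)])
        (auto simp: R)
    then show ?thesis by (simp add: \<Psi>)
  qed
  define k' where "k' y v = R (\<Psi> y) v - v" for y v
  have derk: "(k has_derivative k' y) (at y)" for y
    unfolding k_def k'_def by (intro derivative_intros der\<Psi>)
  \<comment> \<open>The uniform lower bound \<open>c\<close> bounds the inverse derivatives by
    \<open>1 / c\<close>. The resulting Lipschitz bound starts the bootstrap and enters every
    composition in it.\<close>
  have lip: "norm (k x - k y) \<le> (1 / c + 1) * norm (x - y)" for x y
  proof (rule differentiable_bound[OF convex_UNIV])
    show "onorm (k' z) \<le> 1 / c + 1" for z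
    proof (rule onorm_le)
      fix v
      have "norm (R (\<Psi> z) v) \<le> norm v / c"
        using c(2)[of "R (\<Psi> z) v" "\<Psi> z"] c(1) by (simp add: R field_simps)
      then show "norm (k' z v) \<le> (1 / c + 1) * norm v"
        using norm_triangle_ineq4[of "R (\<Psi> z) v" v] by (simp add: k'_def algebra_simps)
    qed
  qed (use derk in auto)
  \<comment> \<open>Since \<open>k y = - f (\<Psi> y)\<close> and \<open>\<Psi> y\<close> is within
    \<open>M\<close> of \<open>y\<close>, decay of \<open>f\<close> gives decay of
    \<open>k\<close>.\<close>
  have k0: "(k \<longlongrightarrow> 0) at_infinity"
    unfolding Lim_at_infinity
  proof (intro allI impI)
    fix e :: real assume "e > 0"
    then obtain b where b: "\<And>x. norm x \<ge> b \<Longrightarrow> norm (f x) < e"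
      using vanishing_holder_tendsto[OF vf] by (auto simp: Lim_at_infinity dist_norm)
    have "norm (k y) < e" if "norm y \<ge> b + M" for y
    proof -
      have "norm y \<le> norm (\<Psi> y) + norm (k y)"
        using norm_triangle_ineq4[of "\<Psi> y" "k y"] by (simp add: \<Psi>k)
      then have "b \<le> norm (\<Psi> y)" using that kM[of y] by linarith
      then show ?thesis using b by (simp add: kf)
    qed
    then show "\<exists>b. \<forall>x. norm x \<ge> b \<longrightarrow> dist (k x) 0 < e" by (auto simp: dist_norm)
  qed
  have "m \<le> Suc n \<Longrightarrow> vh m k" for m
  proof (induction m)
    case 0
    show ?case by (rule Lipschitz_imp_vanishing_holder_0[OF k0 lip])
  next
    case (Suc m)
    then have km: "vh m k" by simp
    have F: "vh m (\<lambda>y. f' (\<Psi> y) j)" if "j \<in> Basis" for j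
      unfolding \<Psi>k
      using vanishing_holder_compose[OF vanishing_holder_mono[OF D(1)[OF that]] km lip] Suc.prems by simp
    have expand: "v + (\<Sum>j\<in>Basis. (v \<bullet> j) *\<^sub>R f' (\<Psi> y) j) = A (\<Psi> y) v" for y v
      using linear_expand_Basis[OF has_derivative_linear[OF f'[of "\<Psi> y"]], of v] by (simp only: A_def)
    show ?case
    proof (rule vanishing_holder_SucI[OF k0 derk])
      fix i :: 'a assume i: "i \<in> Basis"
      show "vh m (\<lambda>y. k' y i)"
      proof (rule vanishing_holder_resolvent[OF c(1) _ F])
        show "c * norm v \<le> norm (v + (\<Sum>j\<in>Basis. (v \<bullet> j) *\<^sub>R f' (\<Psi> y) j))" for y v
          unfolding expand by (rule c(2))
        show "vh m (\<lambda>y. - f' (\<Psi> y) i)" by (rule vanishing_holder_minus[OF F[OF i]])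
        \<comment> \<open>Applying \<open>A (\<Psi> y)\<close> to
          \<open>k' y i = R (\<Psi> y) i - i\<close> leaves
          \<open>i - A (\<Psi> y) i\<close>.\<close>
        show "k' y i + (\<Sum>j\<in>Basis. (k' y i \<bullet> j) *\<^sub>R f' (\<Psi> y) j) = - f' (\<Psi> y) i" for y
          unfolding expand unfolding k'_def linear_diff[OF lin] R(2) by (simp add: A_def)
      qed
    qed
  qed
  then have "vh (Suc n) k" by blast
  moreover have "(x + f x) + k (x + f x) = x" for x using \<Psi>(1)[of x] by (simp add: \<Psi>k \<Phi>_def)
  moreover have "(y + k y) + f (y + k y) = y" for y using \<Psi>(2)[of y] by (simp add: \<Psi>k \<Phi>_def)
  ultimately show ?thesis using that by blast
qed

section \<open>The group of Hoelder diffeomorphisms\<close>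

lemma mem_holder_diffeos_iff:
  "\<Phi> \<in> holder_diffeos n \<beta> \<longleftrightarrow>
    (\<exists>f. vh n f \<and> \<Phi> = (\<lambda>x. x + f x)) \<and> (\<forall>x. det (matrix (frechet_derivative \<Phi> (at x))) > 0)"
  by (auto simp: holder_diffeos_def C0_holder_iff_vanishing_holder)

lemma holder_diffeos_differentiable:
  assumes "\<Phi> \<in> holder_diffeos (Suc n) \<beta>"
  shows "(\<Phi> has_derivative frechet_derivative \<Phi> (at x)) (at x)"
proof -
  obtain f where f: "vh (Suc n) f" "\<Phi> = (\<lambda>x. x + f x)" using assms by (auto simp: mem_holder_diffeos_iff)
  then have "\<Phi> differentiable (at x)" by (auto intro: differentiable_add)
  then show ?thesis by (simp add: frechet_derivative_works)
qed

lemma det_frechet_derivative_compose: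
  fixes \<Phi> \<Psi> :: "real ^ 'd \<Rightarrow> real ^ 'd"
  assumes "(\<Psi> has_derivative \<Psi>') (at x)" "(\<Phi> has_derivative \<Phi>') (at (\<Psi> x))"
  shows "det (matrix (frechet_derivative (\<Phi> \<circ> \<Psi>) (at x))) = det (matrix \<Phi>') * det (matrix \<Psi>')"
proof -
  have "frechet_derivative (\<Phi> \<circ> \<Psi>) (at x) = \<Phi>' \<circ> \<Psi>'"
    by (rule frechet_derivative_eqI[OF diff_chain_at[OF assms]])
  then show ?thesis
    using assms by (simp add: matrix_compose det_mul has_derivative_linear)
qed

lemma holder_diffeos_compose:
  assumes "\<Phi> \<in> holder_diffeos (Suc n) \<beta>" "\<Psi> \<in> holder_diffeos (Suc n) \<beta>"
  shows "\<Phi> \<circ> \<Psi> \<in> holder_diffeos (Suc n) \<beta>"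
proof -
  obtain f where f: "vh (Suc n) f" "\<Phi> = (\<lambda>x. x + f x)" using assms by (auto simp: mem_holder_diffeos_iff)
  obtain g where g: "vh (Suc n) g" "\<Psi> = (\<lambda>x. x + g x)" using assms by (auto simp: mem_holder_diffeos_iff)
  obtain L where "\<And>x y. norm (g x - g y) \<le> L * norm (x - y)" using vanishing_holder_Lipschitz[OF g(1)] by metis
  then have "vh (Suc n) (\<lambda>x. g x + f (x + g x))"
    by (intro vanishing_holder_add vanishing_holder_compose f g)
  moreover have "\<Phi> \<circ> \<Psi> = (\<lambda>x. x + (g x + f (x + g x)))" by (auto simp: f g algebra_simps)
  moreover have "det (matrix (frechet_derivative (\<Phi> \<circ> \<Psi>) (at x))) > 0" for x
    using det_frechet_derivative_compose[OF holder_diffeos_differentiable[OF assms(2)]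
        holder_diffeos_differentiable[OF assms(1)]] assms
    by (simp add: mem_holder_diffeos_iff)
  ultimately show ?thesis unfolding mem_holder_diffeos_iff by blast
qed

lemma id_mem_holder_diffeos: "id \<in> holder_diffeos n \<beta>"
proof -
  have "frechet_derivative (id :: real ^ 'd \<Rightarrow> _) (at x) = id" for x
    by (rule frechet_derivative_eqI) (simp add: id_def)
  then have "det (matrix (frechet_derivative (id :: real ^ 'd \<Rightarrow> _) (at x))) > 0" for x
    by (simp add: matrix_id_mat_1)
  then show ?thesis
    unfolding mem_holder_diffeos_iff using vanishing_holder_zero[of n]
    by (auto intro!: exI[of _ "\<lambda>_. 0"] simp del: vanishing_holder.simps)
qed

lemma holder_diffeos_inverse:
  fixes \<Phi> :: "real ^ 'd \<Rightarrow> real ^ 'd"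
  assumes "\<Phi> \<in> holder_diffeos (Suc n) \<beta>"
  shows "\<exists>\<Psi>\<in>holder_diffeos (Suc n) \<beta>. \<Psi> \<circ> \<Phi> = id"
proof -
  obtain f where f: "vh (Suc n) f" "\<Phi> = (\<lambda>x. x + f x)" using assms by (auto simp: mem_holder_diffeos_iff)
  obtain f' where f': "\<And>x. (f has_derivative f' x) (at x)" using vanishing_holder_SucE[OF f(1)] by metis
  have der: "(\<Phi> has_derivative (\<lambda>v. v + f' x v)) (at x)" for x
    unfolding f(2) by (intro derivative_intros f')
  have "v = 0" if "v + f' x v = 0" for x v
  proof -
    have "det (matrix (\<lambda>v. v + f' x v)) \<noteq> 0"
      using assms frechet_derivative_eqI[OF der, of x] by (metis less_irrefl mem_holder_diffeos_iff)
    then have "inj (\<lambda>v. v + f' x v)" using det_nz_iff_inj has_derivative_linear[OF der] by blast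
    then show ?thesis using that linear_injective_0[OF has_derivative_linear[OF der]] by blast
  qed
  then obtain k where k: "vh (Suc n) k" "\<And>x. (x + f x) + k (x + f x) = x" "\<And>y. (y + k y) + f (y + k y) = y"
    using vanishing_holder_inverse[OF f(1) f'] by metis
  define \<Psi> where "\<Psi> = (\<lambda>x. x + k x)"
  have "\<Phi> \<circ> \<Psi> = id" using k(3) by (auto simp: \<Psi>_def f)
  have "det (matrix (frechet_derivative \<Psi> (at y))) > 0" for y
  proof -
    obtain k' where "\<And>x. (k has_derivative k' x) (at x)" using vanishing_holder_SucE[OF k(1)] by metis
    then have "(\<Psi> has_derivative (\<lambda>v. v + k' y v)) (at y)"
      unfolding \<Psi>_def by (intro derivative_intros)
    then have d\<Psi>: "(\<Psi> has_derivative frechet_derivative \<Psi> (at y)) (at y)"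
      by (metis frechet_derivative_eqI)
    \<comment> \<open>Determinants multiply to that of the identity, so positivity passes from
      \<open>\<Phi>\<close> to its inverse.\<close>
    have "det (matrix (frechet_derivative \<Phi> (at (\<Psi> y)))) * det (matrix (frechet_derivative \<Psi> (at y))) =
        det (matrix (frechet_derivative (id :: real ^ 'd \<Rightarrow> _) (at y)))"
      using det_frechet_derivative_compose[OF d\<Psi> holder_diffeos_differentiable[OF assms]]
      by (simp add: \<open>\<Phi> \<circ> \<Psi> = id\<close>)
    moreover have "det (matrix (frechet_derivative \<Phi> (at (\<Psi> y)))) > 0"
      using assms by (simp add: mem_holder_diffeos_iff)
    moreover have "det (matrix (frechet_derivative (id :: real ^ 'd \<Rightarrow> _) (at y))) > 0"
      using id_mem_holder_diffeos[of 0, where 'a = 'd] by (simp only: mem_holder_diffeos_iff)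
    ultimately show ?thesis by (metis zero_less_mult_pos)
  qed
  then have "\<Psi> \<in> holder_diffeos (Suc n) \<beta>"
    unfolding mem_holder_diffeos_iff using k(1) \<Psi>_def by blast
  moreover have "\<Psi> \<circ> \<Phi> = id" using k(2) by (auto simp: \<Psi>_def f)
  ultimately show ?thesis by blast
qed

lemma group_holder_diffeo_group:
  "group (holder_diffeo_group (Suc n) \<beta>)"
  by (rule groupI)
    (auto simp: holder_diffeo_group_def holder_diffeos_compose id_mem_holder_diffeos o_assoc
      holder_diffeos_inverse)

end

section \<open>Discontinuity of a left translation\<close>

text \<open>Away from 0 the function is locally a power or zero. At 0 the difference quotient is at
  most \<open>\<bar>h\<bar> powr (a - 1)\<close>, which tends to 0 because
  \<open>a > 1\<close>.\<close>

lemma has_real_derivative_pos_part_powr: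
  fixes a t :: real
  assumes "a > 1"
  shows "((\<lambda>t. max 0 t powr a) has_real_derivative a * max 0 t powr (a - 1)) (at t)"
proof (cases "t = 0")
  case True
  have "((\<lambda>h. \<bar>h\<bar> powr (a - 1)) \<longlongrightarrow> \<bar>0\<bar> powr (a - 1)) (at (0::real))"
    using assms by (intro tendsto_powr' tendsto_intros) auto
  then have "((\<lambda>h. \<bar>h\<bar> powr (a - 1)) \<longlongrightarrow> 0) (at (0::real))" by simp
  then have "((\<lambda>h. max 0 h powr a / h) \<longlongrightarrow> 0) (at 0)"
  proof (rule Lim_null_comparison[rotated])
    have "norm (max 0 h powr a / h) \<le> \<bar>h\<bar> powr (a - 1)" for h :: real
    proof (cases "h > 0")
      case True
      then have "max 0 h powr a / h = h powr (a - 1)" by (simp add: powr_diff)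
      then show ?thesis using True by simp
    qed (simp add: max_def)
    then show "\<forall>\<^sub>F h in at 0. norm (max 0 h powr a / h) \<le> \<bar>h\<bar> powr (a - 1)" by simp
  qed
  then show ?thesis using True by (simp add: DERIV_def)
next
  case False
  show ?thesis
  proof (cases "t > 0")
    case True
    have "((\<lambda>t. t powr a) has_real_derivative a * max 0 t powr (a - 1)) (at t)"
      using has_real_derivative_powr[OF True, of a] True by simp
    then show ?thesis
      by (rule has_field_derivative_transform_within_open[of _ _ _ "{0<..}"]) (use True in auto)
  next
    case neg: False
    have "((\<lambda>t. 0) has_real_derivative a * max 0 t powr (a - 1)) (at t)"
      using neg by (simp add: max_def)
    then show ?thesis
      by (rule has_field_derivative_transform_within_open[of _ _ _ "{..<0}"]) (use neg False in auto)
  qed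
qed

lemma has_real_derivative_pos_part_powr_minus:
  fixes a c t :: real
  assumes "a > 1"
  shows "((\<lambda>t. max 0 (c - t) powr a) has_real_derivative - (a * max 0 (c - t) powr (a - 1))) (at t)"
proof -
  have "((\<lambda>t. c - t) has_real_derivative - 1) (at t)"
    by (auto intro!: derivative_eq_intros)
  from DERIV_chain2[where f = "\<lambda>t. max 0 t powr a",
      OF has_real_derivative_pos_part_powr[OF assms] this]
  show ?thesis by simp
qed

text \<open>Reduces iterated derivatives in the single direction \<open>e\<close> to one-variable
  calculus. Openness of \<open>S\<close> allows the formula for \<open>g\<close> to hold only
  locally.\<close>

lemma nth_deriv_along_line:
  fixes g :: "'a::real_inner \<Rightarrow> 'b::real_normed_vector" and h :: "nat \<Rightarrow> real \<Rightarrow> real"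
  assumes "open S" "e \<bullet> e = 1" and g: "\<And>x. x \<in> S \<Longrightarrow> g x = h 0 (x \<bullet> e) *\<^sub>R w"
    and h: "\<And>l t. l < n \<Longrightarrow> (h l has_real_derivative h (Suc l) t) (at t)"
    and "l \<le> n" "x \<in> S"
  shows "nth_deriv l g x (replicate l e) = h l (x \<bullet> e) *\<^sub>R w"
  using assms(5,6)
proof (induction l arbitrary: x)
  case 0
  then show ?case by (simp add: g)
next
  case (Suc l)
  have "((\<lambda>y. h l (y \<bullet> e)) has_derivative (\<lambda>v. (v \<bullet> e) * h (Suc l) (x \<bullet> e))) (at x)"
    using Suc.prems by (intro DERIV_compose_FDERIV[OF h]) (auto intro!: derivative_eq_intros)
  then have "((\<lambda>y. h l (y \<bullet> e) *\<^sub>R w) has_derivative (\<lambda>v. ((v \<bullet> e) * h (Suc l) (x \<bullet> e)) *\<^sub>R w)) (at x)"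
    by (rule has_derivative_scaleR_left)
  then have "((\<lambda>y. nth_deriv l g y (replicate l e)) has_derivative
      (\<lambda>v. ((v \<bullet> e) * h (Suc l) (x \<bullet> e)) *\<^sub>R w)) (at x)"
    by (rule has_derivative_transform_within_open[OF _ assms(1) Suc.prems(2)]) (use Suc in auto)
  from frechet_derivative_eqI[OF this] show ?case by (simp add: assms(2))
qed

section \<open>Scaling of the norm and determinants near the identity\<close>

lemma nth_deriv_cmult:
  assumes "Cn_map n f" "l \<le> n" "length vs = l"
  shows "nth_deriv l (\<lambda>x. c *\<^sub>R f x) x vs = c *\<^sub>R nth_deriv l f x vs"
  using assms(2,3)
proof (induction l arbitrary: x vs)
  case (Suc l)
  have "(\<lambda>y. nth_deriv l (\<lambda>x. c *\<^sub>R f x) y (tl vs)) = (\<lambda>y. c *\<^sub>R nth_deriv l f y (tl vs))"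
    using Suc by auto
  moreover have "(\<lambda>y. nth_deriv l f y (tl vs)) differentiable (at x)"
    using assms(1) Suc.prems by (auto simp: Cn_map_def)
  then have "((\<lambda>y. nth_deriv l f y (tl vs)) has_derivative
      frechet_derivative (\<lambda>y. nth_deriv l f y (tl vs)) (at x)) (at x)"
    by (simp add: frechet_derivative_works)
  then have "((\<lambda>y. c *\<^sub>R nth_deriv l f y (tl vs)) has_derivative
     (\<lambda>h. c *\<^sub>R frechet_derivative (\<lambda>y. nth_deriv l f y (tl vs)) (at x) h)) (at x)"
    by (rule has_derivative_scaleR_right)
  ultimately show ?case by (simp add: frechet_derivative_eqI)
qed simp

lemma opnorm_cmult_le:
  assumes "\<And>vs. length vs = l \<Longrightarrow> T vs = c *\<^sub>R S vs"
  shows "opnorm l T \<le> ennreal \<bar>c\<bar> * opnorm l S"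
  unfolding opnorm_def[of l T]
proof (rule SUP_least)
  fix vs :: "'a list" assume vs: "vs \<in> {vs. length vs = l \<and> (\<forall>v\<in>set vs. norm v \<le> 1)}"
  then have "ennreal (norm (T vs)) = ennreal \<bar>c\<bar> * ennreal (norm (S vs))"
    by (simp add: assms ennreal_mult)
  also have "\<dots> \<le> ennreal \<bar>c\<bar> * opnorm l S"
    using vs by (intro mult_left_mono opnorm_upper) auto
  finally show "ennreal (norm (T vs)) \<le> ennreal \<bar>c\<bar> * opnorm l S" .
qed

text \<open>Used to see that small multiples of a fixed perturbation are close to the
  identity.\<close>

lemma holder_norm_cmult_le:
  assumes "Cn_map n f"
  shows "holder_norm n \<beta> (\<lambda>x. c *\<^sub>R f x) \<le> ennreal \<bar>c\<bar> * holder_norm n \<beta> f"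
proof -
  note N = nth_deriv_cmult[OF assms]
  have "Cn_norm n (\<lambda>x. c *\<^sub>R f x) \<le> ennreal \<bar>c\<bar> * Cn_norm n f"
    unfolding Cn_norm_def[of n "\<lambda>x. c *\<^sub>R f x"]
  proof (rule SUP_least, clarify)
    fix l x assume l: "l \<le> n"
    have "opnorm l (nth_deriv l (\<lambda>x. c *\<^sub>R f x) x) \<le> ennreal \<bar>c\<bar> * opnorm l (nth_deriv l f x)"
      using N[OF l] by (rule opnorm_cmult_le)
    also have "\<dots> \<le> ennreal \<bar>c\<bar> * Cn_norm n f"
      unfolding Cn_norm_def using l by (intro mult_left_mono SUP_upper2[of "(l, x)"]) auto
    finally show "opnorm l (nth_deriv l (\<lambda>x. c *\<^sub>R f x) x) \<le> ennreal \<bar>c\<bar> * Cn_norm n f" .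
  qed
  moreover have "holder_seminorm n \<beta> (\<lambda>x. c *\<^sub>R f x) \<le> ennreal \<bar>c\<bar> * holder_seminorm n \<beta> f"
    unfolding holder_seminorm_def[of n \<beta> "\<lambda>x. c *\<^sub>R f x"]
  proof (rule SUP_least, clarify)
    fix x y :: 'a assume "x \<noteq> y"
    let ?p = "ennreal (norm (x - y) powr \<beta>)"
    let ?X = "\<lambda>f. opnorm n (\<lambda>vs. nth_deriv n f x vs - nth_deriv n f y vs)"
    have "?X (\<lambda>x. c *\<^sub>R f x) \<le> ennreal \<bar>c\<bar> * ?X f"
      by (rule opnorm_cmult_le) (simp add: N scaleR_diff_right)
    then have "?X (\<lambda>x. c *\<^sub>R f x) / ?p \<le> ennreal \<bar>c\<bar> * (?X f / ?p)"
      unfolding ennreal_times_divide by (rule divide_right_mono_ennreal)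
    also have "\<dots> \<le> ennreal \<bar>c\<bar> * holder_seminorm n \<beta> f"
      unfolding holder_seminorm_def using \<open>x \<noteq> y\<close>
      by (intro mult_left_mono SUP_upper2[of "(x, y)"]) auto
    finally show "?X (\<lambda>x. c *\<^sub>R f x) / ?p \<le> ennreal \<bar>c\<bar> * holder_seminorm n \<beta> f" .
  qed
  ultimately show ?thesis
    unfolding holder_norm_def
    by (meson max.bounded_iff max.cobounded1 max.cobounded2 mult_left_mono order_trans zero_le)
qed

text \<open>Deform \<open>g\<close> to 0. A nonpositive determinant at the end would, by the
  intermediate value theorem, vanish on the way and give \<open>v \<noteq> 0\<close> with
  \<open>norm v = s * norm (g v)\<close>, contradicting \<open>onorm g < 1\<close>.\<close>

lemma det_near_identity_pos:
  fixes g :: "real ^ 'd \<Rightarrow> real ^ 'd"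
  assumes "linear g" "onorm g < 1"
  shows "det (matrix (\<lambda>v. v + g v)) > 0"
proof (rule ccontr)
  assume neg: "\<not> ?thesis"
  define D where "D s = det (matrix (\<lambda>v. v + s *\<^sub>R g v))" for s :: real
  have lin: "linear (\<lambda>v. v + s *\<^sub>R g v)" for s
    using assms(1) by (intro linear_compose_add linear_compose_scale_right linear_ident)
  have "continuous_on {0..1} D"
    unfolding D_def det_def matrix_def by (auto intro!: continuous_intros)
  moreover have "D 0 = 1" by (simp add: D_def matrix_id_mat_1[unfolded id_def])
  moreover have "D 1 \<le> 0" using neg by (simp add: D_def)
  ultimately obtain s where s: "0 \<le> s" "s \<le> 1" "D s = 0"
    using IVT2'[of D 1 0 0] by auto
  then have "\<not> inj (\<lambda>v. v + s *\<^sub>R g v)" using det_nz_iff_inj[OF lin] by (auto simp: D_def)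
  then obtain v where v: "v + s *\<^sub>R g v = 0" "v \<noteq> 0" unfolding linear_injective_0[OF lin] by blast
  then have "norm v = s * norm (g v)" using s(1) by (metis abs_of_nonneg add_eq_0_iff norm_minus_cancel norm_scaleR)
  also have "\<dots> \<le> norm (g v)" using s by (simp add: mult_left_le_one_le)
  also have "\<dots> \<le> onorm g * norm v"
    using assms(1) by (intro onorm) (simp add: linear_conv_bounded_linear)
  also have "\<dots> < norm v" using assms(2) v(2) by simp
  finally show False by simp
qed

context holder_exponent
begin

section \<open>Vanishing truncated powers and cutoff functions\<close>

text \<open>Subadditivity of the power: the fractions \<open>p / q\<close> and
  \<open>(q - p) / q\<close> add up to 1, and each is at most its own power with exponent
  \<open>\<beta> \<le> 1\<close>.\<close>

lemma pos_part_powr_holder: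
  fixes s t :: real
  shows "\<bar>max 0 s powr \<beta> - max 0 t powr \<beta>\<bar> \<le> \<bar>s - t\<bar> powr \<beta>"
proof -
  have *: "q powr \<beta> - p powr \<beta> \<le> (q - p) powr \<beta>" if "0 \<le> p" "p \<le> q" for p q :: real
  proof (cases "q = 0")
    case False
    then have q: "q > 0" using that by simp
    have le: "x \<le> x powr \<beta>" if "0 \<le> x" "x \<le> 1" for x :: real
      using powr_mono'[of \<beta> 1 x] beta_le_1 that by simp
    have "1 = p / q + (q - p) / q" using q by (simp add: field_simps)
    also have "\<dots> \<le> (p / q) powr \<beta> + ((q - p) / q) powr \<beta>"
      using that q by (intro add_mono le) (auto simp: field_simps)
    also have "\<dots> = (p powr \<beta> + (q - p) powr \<beta>) / q powr \<beta>"
      using that q by (simp add: powr_divide add_divide_distrib)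
    finally show ?thesis using q by (simp add: field_simps)
  qed (use that in auto)
  have **: "\<bar>max 0 s powr \<beta> - max 0 t powr \<beta>\<bar> \<le> \<bar>s - t\<bar> powr \<beta>" if "t \<le> s" for s t :: real
  proof -
    have "max 0 t powr \<beta> \<le> max 0 s powr \<beta>" using that beta_pos by (intro powr_mono2) auto
    moreover have "max 0 s powr \<beta> - max 0 t powr \<beta> \<le> (max 0 s - max 0 t) powr \<beta>"
      using that by (intro *) auto
    moreover have "(max 0 s - max 0 t) powr \<beta> \<le> \<bar>s - t\<bar> powr \<beta>"
      using that beta_pos by (intro powr_mono2) auto
    ultimately show ?thesis by simp
  qed
  show ?thesis
    using **[of t s] **[of s t] by (cases "t \<le> s") (auto simp: abs_minus_commute)
qed

text \<open>Subtracting from \<open>c powr (real m + \<beta>)\<close> makes the map vanish at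
  infinity. The case \<open>c = 1/2\<close> yields cutoffs, the case \<open>c = 0\<close> the map of
  limited regularity behind the discontinuity.\<close>

lemma vanishing_holder_truncated_power:
  fixes f :: "'a::euclidean_space \<Rightarrow> real"
  assumes "vh m f" and L: "\<And>x y. norm (f x - f y) \<le> L * norm (x - y)" and c: "c \<ge> 0"
  shows "vh m (\<lambda>x. c powr (real m + \<beta>) - max 0 (c - f x) powr (real m + \<beta>))"
  using assms(1)
proof (induction m)
  case 0
  have "norm (c powr \<beta> - max 0 (c - f x) powr \<beta> - (c powr \<beta> - max 0 (c - f y) powr \<beta>)) \<le>
      \<bar>L\<bar> powr \<beta> * norm (x - y) powr \<beta>" for x y
  proof -
    have "norm (c powr \<beta> - max 0 (c - f x) powr \<beta> - (c powr \<beta> - max 0 (c - f y) powr \<beta>)) \<le>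
        \<bar>(c - f y) - (c - f x)\<bar> powr \<beta>"
      using pos_part_powr_holder[of "c - f y" "c - f x"] by simp
    also have "\<dots> \<le> (\<bar>L\<bar> * norm (x - y)) powr \<beta>"
      using L[of x y] mult_right_mono[OF abs_ge_self[of L] norm_ge_zero[of "x - y"]] beta_pos
      by (intro powr_mono2) auto
    finally show ?thesis by (simp add: powr_mult)
  qed
  moreover have "((\<lambda>x. c powr \<beta> - max 0 (c - f x) powr \<beta>) \<longlongrightarrow> c powr \<beta> - max 0 (c - 0) powr \<beta>) at_infinity"
    using beta_pos vanishing_holder_tendsto[OF 0] by (intro tendsto_intros tendsto_powr') auto
  then have "((\<lambda>x. c powr \<beta> - max 0 (c - f x) powr \<beta>) \<longlongrightarrow> 0) at_infinity"
    using c by (simp add: max_def)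
  ultimately show ?case unfolding vanishing_holder.simps by auto
next
  case (Suc m)
  define a where "a = real (Suc m) + \<beta>"
  have a: "a > 1" "a - 1 = real m + \<beta>" using beta_pos by (auto simp: a_def)
  obtain f' where f': "(f \<longlongrightarrow> 0) at_infinity" "\<And>x. (f has_derivative f' x) (at x)"
    "\<And>i. i \<in> Basis \<Longrightarrow> vh m (\<lambda>x. f' x i)"
    using vanishing_holder_SucE[OF Suc.prems] by metis
  let ?g = "\<lambda>x. c powr (real m + \<beta>) - max 0 (c - f x) powr (real m + \<beta>)"
  have IH: "vh m ?g" by (rule Suc.IH[OF vanishing_holder_SucD[OF Suc.prems]])
  have "vh (Suc m) (\<lambda>x. c powr a - max 0 (c - f x) powr a)"
  proof (rule vanishing_holder_SucI)
    have "((\<lambda>x. c powr a - max 0 (c - f x) powr a) \<longlongrightarrow> c powr a - max 0 (c - 0) powr a) at_infinity"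
      using a f'(1) by (intro tendsto_intros tendsto_powr') auto
    then show "((\<lambda>x. c powr a - max 0 (c - f x) powr a) \<longlongrightarrow> 0) at_infinity"
      using c by (simp add: max_def)
    \<comment> \<open>The truncated power of exponent \<open>a - 1\<close> is rewritten as a
      constant minus \<open>?g\<close>, so that each term is a product of vanishing maps or a
      multiple of \<open>f'\<close>.\<close>
    show "((\<lambda>x. c powr a - max 0 (c - f x) powr a) has_derivative
        (\<lambda>h. (a * c powr (real m + \<beta>)) *\<^sub>R f' x h - a *\<^sub>R (?g x * f' x h))) (at x)" for x
    proof -
      have "((\<lambda>x. max 0 (c - f x) powr a) has_derivative
          (\<lambda>h. f' x h * - (a * max 0 (c - f x) powr (a - 1)))) (at x)"
        by (rule DERIV_compose_FDERIV[where f = "\<lambda>t. max 0 (c - t) powr a",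
              OF has_real_derivative_pos_part_powr_minus[OF a(1)] f'(2)])
      then have "((\<lambda>x. c powr a - max 0 (c - f x) powr a) has_derivative
          (\<lambda>h. 0 - f' x h * - (a * max 0 (c - f x) powr (a - 1)))) (at x)"
        by (intro has_derivative_diff has_derivative_const)
      then show ?thesis by (simp add: a(2) algebra_simps)
    qed
    show "vh m (\<lambda>x. (a * c powr (real m + \<beta>)) *\<^sub>R f' x i - a *\<^sub>R (?g x * f' x i))"
      if "i \<in> Basis" for i
      by (intro vanishing_holder_diff vanishing_holder_cmult vanishing_holder_mult IH f'(3) that)
  qed
  then show ?case by (simp only: a_def)
qed

text \<open>
  With \<open>w = 1 / (1 + \<parallel>x\<parallel>\<^sup>2)\<close> and \<open>r\<^sub>u = (x \<bullet> u) w\<close> the derivatives in direction \<open>i\<close> are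
  \<open>-2 r\<^sub>i w\<close> and \<open>(i \<bullet> u) w - 2 r\<^sub>i r\<^sub>u\<close>: the system is closed under differentiation within the
  algebra it generates, so smoothness and decay of all orders follow by induction.
\<close>

lemma vanishing_holder_rational:
  fixes u :: "'a::euclidean_space"
  shows "vh n (\<lambda>x::'a. 1 / (1 + x \<bullet> x))"
    and "vh n (\<lambda>x::'a. (x \<bullet> u) / (1 + x \<bullet> x))"
proof -
  define w where "w x = 1 / (1 + x \<bullet> x)" for x :: 'a
  define r where "r u x = (x \<bullet> u) / (1 + x \<bullet> x)" for u x :: 'a
  have pos: "1 + x \<bullet> x > 0" for x :: 'a by (simp add: add_pos_nonneg)
  have nz: "1 + x \<bullet> x \<noteq> 0" for x :: 'a using pos[of x] by simp
  have rw: "r u x = (x \<bullet> u) * w x" for u x by (simp add: r_def w_def)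
  have dw: "(w has_derivative (\<lambda>h. - 2 * (r h x * w x))) (at x)" for x
  proof -
    have "((\<lambda>t. 1 / (1 + t)) has_real_derivative - (1 / (1 + x \<bullet> x)\<^sup>2)) (at (x \<bullet> x))"
      using nz[of x] by (auto intro!: derivative_eq_intros simp: power2_eq_square)
    moreover have "((\<lambda>x. x \<bullet> x) has_derivative (\<lambda>h. 2 * (x \<bullet> h))) (at x)"
      by (auto intro!: derivative_eq_intros simp: inner_commute)
    ultimately have "((\<lambda>x. 1 / (1 + x \<bullet> x)) has_derivative
        (\<lambda>h. 2 * (x \<bullet> h) * - (1 / (1 + x \<bullet> x)\<^sup>2))) (at x)"
      by (rule DERIV_compose_FDERIV)
    then show ?thesis by (simp add: w_def[abs_def] r_def power2_eq_square)
  qed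
  have dr: "(r u has_derivative (\<lambda>h. (h \<bullet> u) * w x - 2 * (r h x * r u x))) (at x)" for u x
  proof -
    have "((\<lambda>x. (x \<bullet> u) * w x) has_derivative
        (\<lambda>h. (x \<bullet> u) * (- 2 * (r h x * w x)) + (h \<bullet> u) * w x)) (at x)"
      by (intro has_derivative_mult dw bounded_linear.has_derivative[OF bounded_linear_inner_left]
          has_derivative_ident)
    then show ?thesis by (simp add: rw[abs_def] algebra_simps)
  qed
  have w1: "\<bar>w x\<bar> \<le> 1" for x using pos[of x] by (simp add: w_def)
  have rh: "\<bar>r h x\<bar> \<le> norm h * (norm x / (1 + (norm x)\<^sup>2))" for h x
  proof -
    have "\<bar>r h x\<bar> = \<bar>x \<bullet> h\<bar> / (1 + (norm x)\<^sup>2)"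
      using pos[of x] by (simp add: r_def power2_norm_eq_inner)
    also have "\<dots> \<le> (norm x * norm h) / (1 + (norm x)\<^sup>2)"
      by (intro divide_right_mono Cauchy_Schwarz_ineq2) auto
    finally show ?thesis by (simp add: mult.commute)
  qed
  have frac: "t / (1 + t\<^sup>2) \<le> 1" if "t \<ge> 0" for t :: real
  proof -
    have "0 \<le> (t - 1)\<^sup>2" by simp
    then have "2 * t \<le> 1 + t\<^sup>2" by (simp add: power2_diff)
    moreover have "0 < 1 + t\<^sup>2" by (simp add: add_pos_nonneg)
    ultimately show ?thesis using that by (simp add: divide_le_eq)
  qed
  have r1: "\<bar>r h x\<bar> \<le> norm h" for h x
    using rh[of h x] mult_left_mono[OF frac[of "norm x"] norm_ge_zero[of h]] by simp
  have inv0: "((\<lambda>x::'a. inverse (norm x)) \<longlongrightarrow> 0) at_infinity"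
    by (rule tendsto_inverse_0_at_top[OF filterlim_norm_at_top])
  have small: "norm x / (1 + (norm x)\<^sup>2) \<le> inverse (norm x)" "w x \<le> inverse (norm x)"
    if "x \<noteq> 0" for x :: 'a
  proof -
    have "0 < norm x" "0 < 1 + (norm x)\<^sup>2" using that by (auto simp: add_pos_nonneg)
    then show "norm x / (1 + (norm x)\<^sup>2) \<le> inverse (norm x)"
      by (simp add: field_simps power2_eq_square)
    have "0 \<le> (norm x - 1)\<^sup>2" by simp
    then have "2 * norm x \<le> 1 + (norm x)\<^sup>2" by (simp add: power2_diff)
    then have "norm x \<le> 1 + (norm x)\<^sup>2" using norm_ge_zero[of x] by linarith
    then show "w x \<le> inverse (norm x)"
      using \<open>0 < norm x\<close> \<open>0 < 1 + (norm x)\<^sup>2\<close> by (simp add: w_def power2_norm_eq_inner[symmetric] field_simps)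
  qed
  have ev: "eventually (\<lambda>x::'a. x \<noteq> 0) at_infinity"
    unfolding eventually_at_infinity by (rule exI[of _ 1]) auto
  have w0: "(w \<longlongrightarrow> 0) at_infinity"
  proof (rule Lim_null_comparison[OF _ inv0])
    show "\<forall>\<^sub>F x in at_infinity. norm (w x) \<le> inverse (norm x)"
      using ev by eventually_elim (use small(2) pos in \<open>simp add: w_def\<close>)
  qed
  have r0: "(r u \<longlongrightarrow> 0) at_infinity" for u
  proof (rule Lim_null_comparison)
    show "\<forall>\<^sub>F x in at_infinity. norm (r u x) \<le> norm u * inverse (norm x)"
      using ev
    proof eventually_elim
      case (elim x)
      show ?case using rh[of u x] mult_left_mono[OF small(1)[OF elim] norm_ge_zero[of u]] by simp
    qed
    show "((\<lambda>x::'a. norm u * inverse (norm x)) \<longlongrightarrow> 0) at_infinity"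
      using tendsto_mult_left[OF inv0, of "norm u"] by simp
  qed
  have Lw: "norm (w x - w y) \<le> 2 * norm (x - y)" for x y
  proof (rule differentiable_bound[OF convex_UNIV])
    show "onorm (\<lambda>h. - 2 * (r h x * w x)) \<le> 2" for x
    proof (rule onorm_le)
      fix h show "norm (- 2 * (r h x * w x)) \<le> 2 * norm h"
        using mult_mono[OF r1[of h x] w1[of x]] by (simp add: abs_mult)
    qed
  qed (use dw in auto)
  have Lr: "norm (r u x - r u y) \<le> (3 * norm u) * norm (x - y)" for u x y
  proof (rule differentiable_bound[OF convex_UNIV])
    show "onorm (\<lambda>h. (h \<bullet> u) * w x - 2 * (r h x * r u x)) \<le> 3 * norm u" for x
    proof (rule onorm_le)
      fix h
      have "\<bar>(h \<bullet> u) * w x\<bar> \<le> norm h * norm u"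
        using mult_mono[OF Cauchy_Schwarz_ineq2[of h u] w1[of x]] by (simp add: abs_mult)
      moreover have "\<bar>r h x * r u x\<bar> \<le> norm h * norm u"
        using mult_mono[OF r1[of h x] r1[of u x]] by (simp add: abs_mult)
      ultimately show "norm ((h \<bullet> u) * w x - 2 * (r h x * r u x)) \<le> 3 * norm u * norm h"
        by (simp add: algebra_simps)
    qed
  qed (use dr in auto)
  have "vh n w \<and> (\<forall>u. vh n (r u))"
  proof (induction n)
    case 0
    show ?case
      using Lipschitz_imp_vanishing_holder_0[OF w0 Lw] Lipschitz_imp_vanishing_holder_0[OF r0 Lr] by blast
  next
    case (Suc n)
    have "vh (Suc n) w"
    proof (rule vanishing_holder_SucI[OF w0 dw])
      show "vh n (\<lambda>x. - 2 * (r i x * w x))" for i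
        using vanishing_holder_cmult[of n "\<lambda>x. r i x * w x" "- 2"] Suc.IH
        by (simp add: vanishing_holder_mult)
    qed
    moreover have "vh (Suc n) (r u)" for u
    proof (rule vanishing_holder_SucI[OF r0 dr])
      have "vh n (\<lambda>x. (i \<bullet> u) *\<^sub>R w x - 2 *\<^sub>R (r i x * r u x))" for i
        using Suc.IH by (intro vanishing_holder_diff vanishing_holder_cmult vanishing_holder_mult) auto
      then show "vh n (\<lambda>x. (i \<bullet> u) * w x - 2 * (r i x * r u x))" for i by simp
    qed
    ultimately show ?case by blast
  qed
  then show "vh n (\<lambda>x::'a. 1 / (1 + x \<bullet> x))" "vh n (\<lambda>x::'a. (x \<bullet> u) / (1 + x \<bullet> x))"
    by (simp_all add: w_def[abs_def] r_def[abs_def])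
qed

text \<open>On the unit ball \<open>w \<ge> 1/2\<close>, so the truncated power of
  \<open>1/2 - w\<close> is 0 there and \<open>s\<close> is constant. For the linear function,
  \<open>r = (x \<bullet> e) * w\<close> is divided by a map \<open>M\<close> that equals
  \<open>w\<close> on the ball.\<close>

lemma exists_vanishing_holder_cutoff:
  "\<exists>\<eta>::'a::euclidean_space \<Rightarrow> real. vh n \<eta> \<and> (\<forall>x. norm x \<le> 1 \<longrightarrow> \<eta> x = 1)"
  and exists_vanishing_holder_linear_near_0:
  "\<exists>f::'a::euclidean_space \<Rightarrow> real. vh n f \<and> (\<forall>x. norm x \<le> 1 \<longrightarrow> f x = x \<bullet> e)"
proof -
  define w where "w x = 1 / (1 + x \<bullet> x)" for x :: 'a
  have w: "vh m w" for m unfolding w_def by (rule vanishing_holder_rational)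
  obtain L where L: "\<And>x y. norm (w x - w y) \<le> L * norm (x - y)"
    using vanishing_holder_Lipschitz[OF w[of "Suc 0"]] by metis
  define a where "a = real n + \<beta>"
  have a: "a > 0" using beta_pos by (simp add: a_def)
  define \<kappa> where "\<kappa> = (1/2::real) powr a"
  have \<kappa>: "\<kappa> > 0" by (simp add: \<kappa>_def)
  define s where "s x = \<kappa> - max 0 (1/2 - w x) powr a" for x
  have s: "vh n s"
    unfolding s_def \<kappa>_def a_def by (rule vanishing_holder_truncated_power[OF w L]) simp
  have w_ge: "w x \<ge> 1/2" if "norm x \<le> 1" for x
  proof -
    have "x \<bullet> x \<le> 1" using that power_mono[of "norm x" 1 2] by (simp add: power2_norm_eq_inner)
    then show ?thesis by (simp add: w_def field_simps add_pos_nonneg)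
  qed
  have s_eq: "s x = \<kappa>" if "norm x \<le> 1" for x using w_ge[OF that] a by (simp add: s_def max_def)
  have "vh n (\<lambda>x. (1/\<kappa>) *\<^sub>R s x)" by (rule vanishing_holder_cmult[OF s])
  moreover have "(1/\<kappa>) *\<^sub>R s x = 1" if "norm x \<le> 1" for x using s_eq[OF that] \<kappa> by simp
  ultimately show "\<exists>\<eta>::'a \<Rightarrow> real. vh n \<eta> \<and> (\<forall>x. norm x \<le> 1 \<longrightarrow> \<eta> x = 1)" by blast

  \<comment> \<open>\<open>M\<close> agrees with \<open>w\<close> on the unit ball and is bounded away from \<open>0\<close>.\<close>
  define g where "g x = w x - s x" for x
  define M where "M x = \<kappa> + g x" for x
  have g: "vh n g" unfolding g_def by (intro vanishing_holder_diff w s)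
  \<comment> \<open>Either \<open>w x\<close> is at least 1/4, or \<open>1/2 - w x\<close> exceeds
    1/4 and the truncated power is at least \<open>(1/4) powr a\<close>.\<close>
  define \<delta> where "\<delta> = min (1/4) ((1/4::real) powr a)"
  have \<delta>: "\<delta> > 0" by (simp add: \<delta>_def)
  have M\<delta>: "M x \<ge> \<delta>" for x
  proof -
    have w0: "0 \<le> w x" by (simp add: w_def)
    have M: "M x = w x + max 0 (1/2 - w x) powr a" by (simp add: M_def g_def s_def)
    show ?thesis
    proof (cases "w x \<ge> 1/4")
      case True
      moreover have "0 \<le> max 0 (1/2 - w x) powr a" by simp
      moreover have "\<delta> \<le> 1/4" by (simp add: \<delta>_def)
      ultimately show ?thesis unfolding M by linarith
    next
      case False
      then have "(1/4) powr a \<le> max 0 (1/2 - w x) powr a" using a by (intro powr_mono2) auto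
      moreover have "\<delta> \<le> (1/4) powr a" by (simp add: \<delta>_def)
      ultimately show ?thesis using w0 unfolding M by linarith
    qed
  qed
  then have M0: "M x > 0" for x using \<delta> order_less_le_trans by blast
  \<comment> \<open>\<open>M\<close> tends to \<open>\<kappa>\<close> at infinity, so
    \<open>G\<close> is the vanishing part of \<open>1 / M\<close>. It solves the scalar equation
    \<open>G * (1 + g / \<kappa>) = - g / \<kappa>\<^sup>2\<close>, to which the linear-system lemma
    applies.\<close>
  define G where "G x = 1 / M x - 1 / \<kappa>" for x
  have "vh n G"
  proof (rule vanishing_holder_resolvent[where c = "\<delta> / \<kappa>" and F = "\<lambda>j x. (1/\<kappa>) *\<^sub>R g x"])
    show "\<delta> / \<kappa> > 0" using \<delta> \<kappa> by simp
    show "vh n (\<lambda>x. (1/\<kappa>) *\<^sub>R g x)" by (rule vanishing_holder_cmult[OF g])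
    show "vh n (\<lambda>x. (- 1/\<kappa>\<^sup>2) *\<^sub>R g x)" by (rule vanishing_holder_cmult[OF g])
    fix x
    show "\<delta> / \<kappa> * norm v \<le> norm (v + (\<Sum>j\<in>Basis. (v \<bullet> j) *\<^sub>R (1/\<kappa>) *\<^sub>R g x))" for v
    proof -
      have "v + (\<Sum>j\<in>Basis. (v \<bullet> j) *\<^sub>R (1/\<kappa>) *\<^sub>R g x) = M x / \<kappa> * v"
        using \<kappa> by (simp add: M_def field_simps)
      moreover have "\<delta> / \<kappa> * norm v \<le> M x / \<kappa> * norm v"
        using M\<delta>[of x] \<kappa> by (intro mult_right_mono divide_right_mono) auto
      ultimately show ?thesis using M0[of x] \<kappa> by (simp add: abs_mult)
    qed
    show "G x + (\<Sum>j\<in>Basis. (G x \<bullet> j) *\<^sub>R (1/\<kappa>) *\<^sub>R g x) = (- 1/\<kappa>\<^sup>2) *\<^sub>R g x"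
    proof -
      have "G x + (\<Sum>j\<in>Basis. (G x \<bullet> j) *\<^sub>R (1/\<kappa>) *\<^sub>R g x) = G x * (M x / \<kappa>)"
        using \<kappa> by (simp add: M_def field_simps)
      also have "\<dots> = (\<kappa> - M x) / \<kappa>\<^sup>2"
        using \<kappa> M0[of x] by (simp add: G_def field_simps power2_eq_square)
      finally show ?thesis by (simp add: M_def)
    qed
  qed
  define r where "r x = (x \<bullet> e) / (1 + x \<bullet> x)" for x
  have r: "vh n r" unfolding r_def by (rule vanishing_holder_rational)
  have "vh n (\<lambda>x. (1/\<kappa>) *\<^sub>R r x + G x * r x)"
    by (intro vanishing_holder_add vanishing_holder_cmult vanishing_holder_mult r \<open>vh n G\<close>)
  moreover have "(1/\<kappa>) *\<^sub>R r x + G x * r x = x \<bullet> e" if "norm x \<le> 1" for x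
  proof -
    have "M x = w x" using s_eq[OF that] by (simp add: M_def g_def)
    moreover have "1 + x \<bullet> x > 0" by (simp add: add_pos_nonneg)
    moreover have "(1/\<kappa>) *\<^sub>R r x + G x * r x = r x / M x" by (simp add: G_def algebra_simps)
    ultimately show ?thesis by (simp add: r_def w_def)
  qed
  ultimately show "\<exists>f::'a \<Rightarrow> real. vh n f \<and> (\<forall>x. norm x \<le> 1 \<longrightarrow> f x = x \<bullet> e)" by blast
qed

section \<open>Perturbations of the identity and discontinuity there\<close>

lemma small_perturbation_mem_holder_diffeos:
  fixes f :: "real ^ 'd \<Rightarrow> real ^ 'd"
  assumes "vh (Suc n) f"
  obtains \<delta> where "\<delta> > 0" "\<And>s. \<bar>s\<bar> \<le> \<delta> \<Longrightarrow> (\<lambda>x. x + s *\<^sub>R f x) \<in> holder_diffeos (Suc n) \<beta>"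
proof -
  obtain f' where f': "\<And>x. (f has_derivative f' x) (at x)" using vanishing_holder_SucE[OF assms] by metis
  obtain L where L: "L > 0" "\<And>x. onorm (f' x) \<le> L"
    using vanishing_holder_derivative_bounded[OF assms f'] by metis
  have "(\<lambda>x. x + s *\<^sub>R f x) \<in> holder_diffeos (Suc n) \<beta>" if s: "\<bar>s\<bar> \<le> 1 / (2 * L)" for s
    unfolding mem_holder_diffeos_iff
  proof (intro conjI allI)
    show "\<exists>g. vh (Suc n) g \<and> (\<lambda>x. x + s *\<^sub>R f x) = (\<lambda>x. x + g x)"
      using vanishing_holder_cmult[OF assms] by blast
    fix x
    have "((\<lambda>x. x + s *\<^sub>R f x) has_derivative (\<lambda>v. v + s *\<^sub>R f' x v)) (at x)"
      by (intro derivative_intros f')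
    moreover have "det (matrix (\<lambda>v. v + s *\<^sub>R f' x v)) > 0"
    proof (rule det_near_identity_pos)
      show "linear (\<lambda>v. s *\<^sub>R f' x v)"
        using has_derivative_linear[OF f'] by (rule linear_compose_scale_right)
      have "onorm (\<lambda>v. s *\<^sub>R f' x v) = \<bar>s\<bar> * onorm (f' x)"
        by (rule onorm_scaleR) (rule has_derivative_bounded_linear[OF f'])
      also have "\<dots> \<le> 1 / (2 * L) * L"
        using s L by (intro mult_mono onorm_pos_le has_derivative_bounded_linear[OF f']) auto
      finally show "onorm (\<lambda>v. s *\<^sub>R f' x v) < 1" using L by simp
    qed
    ultimately show "det (matrix (frechet_derivative (\<lambda>x. x + s *\<^sub>R f x) (at x))) > 0"
      by (simp add: frechet_derivative_eqI)
  qed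
  then show ?thesis using that[of "1 / (2 * L)"] L(1) by simp
qed


text \<open>Continuity fails at the identity: \<open>\<Phi> \<epsilon>\<close> is within a multiple
  of \<open>\<epsilon>\<close> of \<open>id\<close>, yet the translates stay at distance at least
  \<open>\<delta> * K\<close>.\<close>

lemma left_translation_discontinuous:
  assumes n: "n = Suc m"
  shows "\<exists>\<Psi>\<in>(holder_diffeos n \<beta> :: (real ^ 'd \<Rightarrow> real ^ 'd) set).
    \<not> continuous_map (holder_diffeo_topology n \<beta>) (holder_diffeo_topology n \<beta>) (\<lambda>\<Phi>. \<Psi> \<circ> \<Phi>)"
proof -
  obtain e :: "real ^ 'd" where e: "e \<in> Basis" using nonempty_Basis by blast
  have ee: "e \<bullet> e = 1" and norm_e: "norm e = 1" using e by (auto simp: inner_Basis)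
  define a where "a = real n + \<beta>"
  obtain f :: "real ^ 'd \<Rightarrow> real" where f: "vh n f" "\<And>x. norm x \<le> 1 \<Longrightarrow> f x = x \<bullet> e"
    using exists_vanishing_holder_linear_near_0 by metis
  obtain L where L: "\<And>x y. norm (f x - f y) \<le> L * norm (x - y)"
    using vanishing_holder_Lipschitz[of m f] f(1) n by metis
  \<comment> \<open>The term \<open>0 powr a\<close> is 0; it is written out to match the
    truncated-power lemma with \<open>c = 0\<close>.\<close>
  define u where "u x = 0 powr a - max 0 (0 - f x) powr a" for x
  have u: "vh n u" unfolding u_def a_def by (rule vanishing_holder_truncated_power[OF f(1) L]) simp
  obtain \<eta> :: "real ^ 'd \<Rightarrow> real" where \<eta>: "vh n \<eta>" "\<And>x. norm x \<le> 1 \<Longrightarrow> \<eta> x = 1"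
    using exists_vanishing_holder_cutoff by metis
  have vec: "vh n (\<lambda>x. g x *\<^sub>R e)" if "vh n g" for g :: "real ^ 'd \<Rightarrow> real"
    using that by (rule vanishing_holder_bounded_linear[OF bounded_linear_scaleR_left])
  obtain \<delta> where \<delta>: "\<delta> > 0" "\<And>s. \<bar>s\<bar> \<le> \<delta> \<Longrightarrow> (\<lambda>x. x + s *\<^sub>R u x *\<^sub>R e) \<in> holder_diffeos n \<beta>"
    using small_perturbation_mem_holder_diffeos[of m "\<lambda>x. u x *\<^sub>R e"] vec[OF u] n by metis
  obtain \<delta>' where \<delta>': "\<delta>' > 0" "\<And>s. \<bar>s\<bar> \<le> \<delta>' \<Longrightarrow> (\<lambda>x. x + s *\<^sub>R \<eta> x *\<^sub>R e) \<in> holder_diffeos n \<beta>"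
    using small_perturbation_mem_holder_diffeos[of m "\<lambda>x. \<eta> x *\<^sub>R e"] vec[OF \<eta>(1)] n by metis
  define \<Psi> where "\<Psi> = (\<lambda>x. x + \<delta> *\<^sub>R u x *\<^sub>R e)"
  define \<Phi> where "\<Phi> \<epsilon> = (\<lambda>x. x + \<epsilon> *\<^sub>R \<eta> x *\<^sub>R e)" for \<epsilon>
  have \<Psi>: "\<Psi> \<in> holder_diffeos n \<beta>" using \<delta> by (simp add: \<Psi>_def)
  \<comment> \<open>The factor produced by differentiating a power with exponent \<open>a\<close>
    \<open>n\<close> times; all its factors exceed \<open>\<beta>\<close>.\<close>
  define K where "K = (\<Prod>i<n. a - real i)"
  have K: "K > 0" using beta_pos by (auto simp: K_def a_def intro!: prod_pos)

  have lower: "\<delta> * K \<le> holder_dist n \<beta> (\<Psi> \<circ> id) (\<Psi> \<circ> \<Phi> \<epsilon>)"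
    if \<epsilon>: "0 < \<epsilon>" "\<epsilon> < 1/2" "\<epsilon> \<le> \<delta>'" for \<epsilon>
  proof -
    have \<Phi>: "\<Phi> \<epsilon> \<in> holder_diffeos n \<beta>" using \<delta>'(2)[of \<epsilon>] \<epsilon> by (simp add: \<Phi>_def)
    have comp: "\<Psi> \<circ> \<Phi> \<epsilon> \<in> holder_diffeos n \<beta>"
      using holder_diffeos_compose[of \<Psi> m "\<Phi> \<epsilon>"] \<Psi> \<Phi> n by simp
    define F where "F x = \<Psi> x - \<Psi> (\<Phi> \<epsilon> x)" for x
    \<comment> \<open>\<open>V l\<close> is the derivative of order \<open>l\<close> of the profile
      \<open>- max 0 (- t) powr a\<close> of \<open>u\<close>, and \<open>h l\<close> that of the
      profile of \<open>F\<close>. The shift \<open>- \<epsilon>\<close> is constant and so appears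
      only for \<open>l = 0\<close>.\<close>
    define V where "V l t = - ((- 1) ^ l * (\<Prod>i<l. a - real i) * max 0 (- t) powr (a - real l))" for l t
    define h where "h l t = (if l = 0 then - \<epsilon> else 0) + \<delta> * (V l t - V l (t + \<epsilon>))" for l t
    have dV: "(V l has_real_derivative V (Suc l) t) (at t)" if "l < n" for l t
    proof -
      have al: "a - real l > 1" using that beta_pos by (simp add: a_def)
      have "((\<lambda>t. max 0 (0 - t) powr (a - real l)) has_real_derivative
          - ((a - real l) * max 0 (0 - t) powr (a - real l - 1))) (at t)"
        by (rule has_real_derivative_pos_part_powr_minus[OF al])
      from DERIV_cmult[OF this, of "- ((- 1) ^ l * (\<Prod>i<l. a - real i))"]
      show ?thesis by (simp add: V_def[abs_def] algebra_simps)
    qed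
    have dh: "(h l has_real_derivative h (Suc l) t) (at t)" if "l < n" for l t
    proof -
      have "((\<lambda>t. V l (t + \<epsilon>)) has_real_derivative V (Suc l) (t + \<epsilon>)) (at t)"
        using dV[OF that, of "t + \<epsilon>"] unfolding DERIV_shift .
      from DERIV_add[OF DERIV_const DERIV_cmult[OF DERIV_diff[OF dV[OF that] this]]]
      show ?thesis by (simp add: h_def[abs_def])
    qed
    have uV: "u x = V 0 (x \<bullet> e)" if "norm x \<le> 1" for x
      using f(2)[OF that] by (simp add: u_def V_def)
    have F: "F x = h 0 (x \<bullet> e) *\<^sub>R e" if "x \<in> ball 0 (1 - \<epsilon>)" for x
    proof -
      have x: "norm x \<le> 1" "norm (x + \<epsilon> *\<^sub>R e) \<le> 1"
        using that \<epsilon> norm_triangle_ineq[of x "\<epsilon> *\<^sub>R e"] by (auto simp: norm_e)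
      have "\<Phi> \<epsilon> x = x + \<epsilon> *\<^sub>R e" using \<eta>(2)[OF x(1)] by (simp add: \<Phi>_def)
      moreover have "u (x + \<epsilon> *\<^sub>R e) = V 0 (x \<bullet> e + \<epsilon>)"
        using uV[OF x(2)] by (simp add: inner_add_left ee)
      ultimately show ?thesis
        using uV[OF x(1)] by (simp add: F_def \<Psi>_def h_def algebra_simps)
    qed
    \<comment> \<open>On this ball both \<open>x\<close> and its shift by
      \<open>\<epsilon> *\<^sub>R e\<close> lie in the unit ball; \<open>\<epsilon> < 1/2\<close>
      puts the second test point inside.\<close>
    have mem: "0 \<in> ball 0 (1 - \<epsilon>)" "- (\<epsilon> *\<^sub>R e) \<in> ball 0 (1 - \<epsilon>)"
      using \<epsilon> by (auto simp: norm_e)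
    have nd: "nth_deriv n F x (replicate n e) = h n (x \<bullet> e) *\<^sub>R e" if "x \<in> ball 0 (1 - \<epsilon>)" for x
      by (rule nth_deriv_along_line[where h = h, OF open_ball ee F dh order_refl that])
    \<comment> \<open>At 0 both truncated powers vanish. At
      \<open>- (\<epsilon> *\<^sub>R e)\<close> only the unshifted one survives, so the difference
      is of size \<open>\<epsilon> powr \<beta>\<close>, which the Hoelder quotient cancels.\<close>
    have "nth_deriv n F 0 (replicate n e) = 0"
      using nd[OF mem(1)] n \<epsilon> by (simp add: h_def V_def)
    moreover have "nth_deriv n F (- (\<epsilon> *\<^sub>R e)) (replicate n e) = (\<delta> * V n (- \<epsilon>)) *\<^sub>R e"
      using nd[OF mem(2)] n by (simp add: h_def V_def ee)
    moreover have "V n (- \<epsilon>) = - ((- 1) ^ n * K * \<epsilon> powr \<beta>)"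
    proof -
      have "a - real n = \<beta>" by (simp add: a_def)
      then show ?thesis using \<epsilon>(1) by (simp add: V_def K_def)
    qed
    then have "norm ((\<delta> * V n (- \<epsilon>)) *\<^sub>R e) = \<delta> * K * \<epsilon> powr \<beta>"
      using \<delta>(1) K by (simp add: norm_e abs_mult)
    ultimately have diff: "norm (nth_deriv n F 0 (replicate n e) - nth_deriv n F (- (\<epsilon> *\<^sub>R e)) (replicate n e)) =
        \<delta> * K * \<epsilon> powr \<beta>" by simp
    have "ennreal (norm (nth_deriv n F 0 (replicate n e) - nth_deriv n F (- (\<epsilon> *\<^sub>R e)) (replicate n e)))
        \<le> holder_seminorm n \<beta> F * ennreal (norm (0 - - (\<epsilon> *\<^sub>R e)) powr \<beta>)"
      by (rule holder_seminorm_upper) (use norm_e \<epsilon> in auto)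
    then have "ennreal (\<delta> * K * \<epsilon> powr \<beta>) \<le> holder_seminorm n \<beta> F * ennreal (\<epsilon> powr \<beta>)"
      using diff \<epsilon> by (simp add: norm_e)
    also have "\<dots> \<le> holder_norm n \<beta> F * ennreal (\<epsilon> powr \<beta>)"
      by (intro mult_right_mono) (auto simp: holder_norm_def)
    finally have le: "ennreal (\<delta> * K * \<epsilon> powr \<beta>) \<le> holder_norm n \<beta> F * ennreal (\<epsilon> powr \<beta>)" .
    \<comment> \<open>Finiteness of the norm of \<open>F\<close> is required before
      \<open>enn2real\<close> in the metric preserves the lower bound.\<close>
    obtain g1 g2 where g: "vh n g1" "\<Psi> = (\<lambda>x. x + g1 x)" "vh n g2" "\<Psi> \<circ> \<Phi> \<epsilon> = (\<lambda>x. x + g2 x)"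
      using \<Psi> comp by (auto simp: mem_holder_diffeos_iff)
    have "F = (\<lambda>x. g1 x - g2 x)"
    proof
      fix x show "F x = g1 x - g2 x"
        using fun_cong[OF g(2), of x] fun_cong[OF g(4), of x] by (simp add: F_def)
    qed
    then have "F \<in> C0_holder n \<beta>"
      using vanishing_holder_diff[OF g(1,3)] by (simp only: C0_holder_iff_vanishing_holder)
    then have "holder_norm n \<beta> F < \<infinity>" by (simp add: C0_holder_def)
    then obtain X where X: "X \<ge> 0" "holder_norm n \<beta> F = ennreal X" by (cases "holder_norm n \<beta> F") auto
    then have "\<delta> * K * \<epsilon> powr \<beta> \<le> X * \<epsilon> powr \<beta>"
      using le by (simp add: ennreal_mult[symmetric])
    then have "\<delta> * K \<le> X" using \<epsilon> by simp
    moreover have "holder_dist n \<beta> (\<Psi> \<circ> id) (\<Psi> \<circ> \<Phi> \<epsilon>) = X"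
      using \<Psi> comp X by (simp add: holder_dist_def F_def[abs_def, symmetric])
    ultimately show ?thesis by simp
  qed

  have "\<not> continuous_map (holder_diffeo_topology n \<beta>) (holder_diffeo_topology n \<beta>) (\<lambda>\<Phi>. \<Psi> \<circ> \<Phi>)"
  proof
    assume "continuous_map (holder_diffeo_topology n \<beta>) (holder_diffeo_topology n \<beta>) (\<lambda>\<Phi>. \<Psi> \<circ> \<Phi>)"
    then have "\<forall>\<Xi>\<^sub>0\<in>holder_diffeos n \<beta>. \<forall>r>0. \<exists>\<rho>>0. \<forall>\<Xi>. \<Xi> \<in> holder_diffeos n \<beta> \<and>
        holder_dist n \<beta> \<Xi>\<^sub>0 \<Xi> < \<rho> \<longrightarrow> holder_dist n \<beta> (\<Psi> \<circ> \<Xi>\<^sub>0) (\<Psi> \<circ> \<Xi>) < r"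
      unfolding holder_diffeo_topology_def
        Metric_space.metric_continuous_map[OF Metric_space_holder_diffeos Metric_space_holder_diffeos]
      by (rule conjunct2)
    \<comment> \<open>Continuity is tested at \<open>id\<close> with radius
      \<open>\<delta> * K\<close>, the bound from \<open>lower\<close>.\<close>
    from this[rule_format, OF id_mem_holder_diffeos, of "\<delta> * K"]
    obtain \<rho> where \<rho>: "\<rho> > 0" "\<And>\<Xi>. \<Xi> \<in> holder_diffeos n \<beta> \<Longrightarrow>
        holder_dist n \<beta> id \<Xi> < \<rho> \<Longrightarrow> holder_dist n \<beta> (\<Psi> \<circ> id) (\<Psi> \<circ> \<Xi>) < \<delta> * K"
      using \<delta>(1) K by auto
    have \<eta>C: "(\<lambda>x. \<eta> x *\<^sub>R e) \<in> C0_holder n \<beta>"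
      using vec[OF \<eta>(1)] by (simp only: C0_holder_iff_vanishing_holder)
    then have Cn: "Cn_map n (\<lambda>x. \<eta> x *\<^sub>R e)" and "holder_norm n \<beta> (\<lambda>x. \<eta> x *\<^sub>R e) < \<infinity>"
      by (auto simp: C0_holder_def)
    then obtain H where H: "H \<ge> 0" "holder_norm n \<beta> (\<lambda>x. \<eta> x *\<^sub>R e) = ennreal H"
      by (cases "holder_norm n \<beta> (\<lambda>x. \<eta> x *\<^sub>R e)") auto
    \<comment> \<open>The first two bounds meet the hypotheses of \<open>lower\<close>; the third
      gives \<open>\<epsilon> * H < \<rho>\<close>, with \<open>H + 1\<close> avoiding division by
      0.\<close>
    define \<epsilon> where "\<epsilon> = min (min (1/4) \<delta>') (\<rho> / (2 * (H + 1)))"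
    have \<epsilon>: "0 < \<epsilon>" "\<epsilon> < 1/2" "\<epsilon> \<le> \<delta>'" using \<rho>(1) \<delta>'(1) H(1) by (auto simp: \<epsilon>_def)
    have "\<epsilon> * H \<le> \<rho> / (2 * (H + 1)) * H" using H(1) by (intro mult_right_mono) (auto simp: \<epsilon>_def)
    also have "\<dots> < \<rho>" using \<rho>(1) H(1) by (simp add: field_simps add_nonneg_pos)
    finally have \<epsilon>H: "\<epsilon> * H < \<rho>" .
    have \<Phi>: "\<Phi> \<epsilon> \<in> holder_diffeos n \<beta>" using \<delta>'(2)[of \<epsilon>] \<epsilon> by (simp add: \<Phi>_def)
    have "(\<lambda>x. id x - \<Phi> \<epsilon> x) = (\<lambda>x. (- \<epsilon>) *\<^sub>R \<eta> x *\<^sub>R e)" by (simp add: \<Phi>_def fun_eq_iff)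
    then have "holder_norm n \<beta> (\<lambda>x. id x - \<Phi> \<epsilon> x) \<le> ennreal (\<epsilon> * H)"
      using holder_norm_cmult_le[OF Cn, of \<beta> "- \<epsilon>"] \<epsilon>(1) H by (simp add: ennreal_mult)
    then have "enn2real (holder_norm n \<beta> (\<lambda>x. id x - \<Phi> \<epsilon> x)) \<le> \<epsilon> * H"
      using \<epsilon>(1) H(1) by (intro enn2real_leI) auto
    then have "holder_dist n \<beta> id (\<Phi> \<epsilon>) < \<rho>"
      using \<epsilon>H \<Phi> \<rho>(1) by (simp add: holder_dist_def)
    from \<rho>(2)[OF \<Phi> this] lower[OF \<epsilon>] show False by simp
  qed
  with \<Psi> show ?thesis by blast
qed

end

theorem theorem3p4:
  fixes n :: nat and \<beta> :: real
  assumes "n \<ge> 1" and "0 < \<beta>" and "\<beta> \<le> 1"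
  shows "group (holder_diffeo_group n \<beta> :: (real ^ 'd \<Rightarrow> real ^ 'd) monoid) \<and>
    (\<exists>\<Psi> \<in> (holder_diffeos n \<beta> :: (real ^ 'd \<Rightarrow> real ^ 'd) set).
       \<not> continuous_map (holder_diffeo_topology n \<beta>) (holder_diffeo_topology n \<beta>) (\<lambda>\<Phi>. \<Psi> \<circ> \<Phi>))"
proof -
  interpret holder_exponent \<beta> using assms by unfold_locales
  obtain m where m: "n = Suc m" using assms(1) by (cases n) auto
  show ?thesis
    using group_holder_diffeo_group[of m] left_translation_discontinuous[OF m] by (simp only: m)
qed

end
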